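(* Let $k>1$ and $q>2$ be integers, let $d\ge1$ be a square-free integer and let $\mathbb{K}=\mathbb{Q}(i\sqrt{d})$. Assume $\mathbb{K}\cap\mathbb{Q}(\zeta_q)=\mathbb{Q}(i\sqrt{d})$. Let $V_{ar}(\mathbb{K})$ be the $\mathbb{K}$-linear span of the numbers $$\zeta(k,a/q)+(-1)^k\zeta(k,1-a/q),\qquad 1\le a<q/2,\ \gcd(a,q)=1,$$ and let $\widehat{V}_k(q,\mathbb{K})$ be the $\mathbb{K}$-linear span of the numbers $1$ and $\zeta(k,a/q)$ for $1\le a<q$, $\gcd(a,q)=1$. Then $\dim_{\mathbb{K}}V_{ar}(\mathbb{K})=\varphi(q)/2$, and consequently $$\dim_{\mathbb{K}}\widehat{V}_k(q,\mathbb{K})\ge\frac{\varphi(q)}{2}+1.$$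
   Context: For $0<x\le1$ and $\Re(s)>1$, the Hurwitz zeta function is $\zeta(s,x)=\sum_{n\ge0}(n+x)^{-s}$. $\zeta_q=e^{2\pi i/q}$ and $\varphi$ is Euler's totient function. *)

theory Defs
  imports
    "HOL-Analysis.Analysis"
    "HOL-Number_Theory.Totient"
    "HOL-Computational_Algebra.Squarefree"
    "HOL-Algebra.Generated_Fields"
    "HOL-Algebra.Embedded_Algebras"
    "HOL-Algebra.Algebraic_Closure_Type"
begin

abbreviation complex_ring :: "complex ring" where
  "complex_ring \<equiv> ring_of_type_algebra"

text \<open>The subfield generated by \<open>z\<close> contains the prime field, so this is \<open>\<rat>(z)\<close>.\<close>

definition rat_adjoin :: "complex \<Rightarrow> complex set" where
  "rat_adjoin z = generate_field complex_ring {z}"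

lemma subfield_rat_adjoin: "subfield (rat_adjoin z) complex_ring"
proof -
  interpret field complex_ring
    by (rule field_from_type_algebra)
  show ?thesis
    unfolding rat_adjoin_def
    by (rule generate_field_is_subfield) (simp add: ring_of_type_algebra_def)
qed

text \<open>Meaningful for \<open>0 < x \<le> 1\<close> and \<open>Re s > 1\<close> only, where the series converges; no analytic
  continuation is involved. The base is a positive real, so \<open>powr\<close> uses its real logarithm.\<close>

definition hurwitz_zeta :: "complex \<Rightarrow> real \<Rightarrow> complex" where
  "hurwitz_zeta s x = (\<Sum>n. complex_of_real (real n + x) powr (- s))"

definition zeta_root :: "nat \<Rightarrow> complex" where
  "zeta_root q = exp (2 * of_real pi * \<i> / of_nat q)"

text \<open>The spanning families are finite and are given as lists, as \<^const>\<open>ring.Span\<close> expects.\<close>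

definition V_ar :: "nat \<Rightarrow> nat \<Rightarrow> complex set \<Rightarrow> complex set" where
  "V_ar k q K = ring.Span complex_ring K
     (map (\<lambda>a. hurwitz_zeta (of_nat k) (real a / real q)
                + (- 1) ^ k * hurwitz_zeta (of_nat k) (1 - real a / real q))
       (filter (\<lambda>a. 2 * a < q \<and> coprime a q) [1..<q]))"

definition V_hat :: "nat \<Rightarrow> nat \<Rightarrow> complex set \<Rightarrow> complex set" where
  "V_hat k q K = ring.Span complex_ring K
     (1 # map (\<lambda>a. hurwitz_zeta (of_nat k) (real a / real q))
            (filter (\<lambda>a. coprime a q) [1..<q]))"

end

theory Submission
  imports Defs
begin

text \<open>The numbers spanning \<open>V_ar\<close> are real, so over an imaginary quadratic field they are linearly
  independent as soon as they are independent over \<open>\<rat>\<close>: take real and imaginary parts.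

  By the reflection formula for the polygamma function, the number belonging to \<open>a\<close> is a rational
  multiple of \<open>(\<pi> \<i>) ^ k\<close> times \<open>P (\<zeta> ^ a) / (\<zeta> ^ a - 1) ^ k\<close> with an integral polynomial
  \<open>P\<close>. Since the cyclotomic polynomial is irreducible, an integral relation with coefficients \<open>c a\<close>
  persists when each \<open>a\<close> is replaced by \<open>a * b mod q\<close>, for every \<open>b\<close> coprime to \<open>q\<close>. If \<open>\<bar>c a\<bar>\<close> is
  maximal at \<open>a0\<close> and \<open>b\<close> is the inverse of \<open>a0\<close>, then \<open>\<zeta>(k, 1/q) \<ge> q ^ k\<close> outweighs the
  other terms, because the sum of all \<open>\<zeta>(k, r/q)\<close> with \<open>1 \<le> r \<le> q\<close> is \<open>q ^ k \<zeta>(k) \<le> 2 q ^ k\<close>.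

  The number \<open>1\<close> is independent of \<open>V_ar\<close> because \<open>\<pi>\<close> is transcendental. This follows from Hermite's
  argument applied to the subset sums of the conjugates of \<open>\<pi> \<i>\<close>; logarithmic derivatives of formal
  power series replace the fundamental theorem on symmetric polynomials.\<close>

hide_const (open) Polynomials.degree up_ring.coeff up_ring.monom module.smult Divisibility.prime

section \<open>Power sums of roots\<close>

text \<open>A subring of a field of characteristic 0. The same arguments then serve the rationals,
  where positive integers have inverses, and the integers, where they do not.\<close>

locale coefficient_ring =
  fixes R :: "'a::field_char_0 set"
  assumes zero_mem [simp]: "0 \<in> R" and one_mem [simp]: "1 \<in> R"
    and add_mem: "x \<in> R \<Longrightarrow> y \<in> R \<Longrightarrow> x + y \<in> R"
    and mult_mem: "x \<in> R \<Longrightarrow> y \<in> R \<Longrightarrow> x * y \<in> R"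
    and uminus_mem: "x \<in> R \<Longrightarrow> - x \<in> R"
begin

lemma diff_mem: "x \<in> R \<Longrightarrow> y \<in> R \<Longrightarrow> x - y \<in> R"
  using add_mem[of x "- y"] uminus_mem[of y] by simp

lemma of_nat_mem: "of_nat n \<in> R"
  by (induction n) (auto intro: add_mem)

lemma sum_mem: "(\<And>i. i \<in> A \<Longrightarrow> f i \<in> R) \<Longrightarrow> sum f A \<in> R"
  by (induction A rule: infinite_finite_induct) (auto intro: add_mem)

text \<open>Comparing coefficients in the Cauchy product expresses the coefficient \<open>n\<close>
  of \<open>S\<close> through earlier ones; the only division is by the constant term of
  \<open>H\<close>.\<close>

lemma fps_quotient_mem:
  assumes H: "\<And>n. fps_nth H n \<in> R" and unit: "fps_nth H 0 \<noteq> 0" "inverse (fps_nth H 0) \<in> R"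
    and HS: "\<And>n. fps_nth (H * S) n \<in> R"
  shows "fps_nth S n \<in> R"
proof (induction n rule: less_induct)
  case (less n)
  have "fps_nth (H * S) n = fps_nth H 0 * fps_nth S n + (\<Sum>i = 1..n. fps_nth H i * fps_nth S (n - i))"
    by (simp add: fps_mult_nth sum.atLeast_Suc_atMost)
  hence "fps_nth S n = inverse (fps_nth H 0) *
      (fps_nth (H * S) n - (\<Sum>i = 1..n. fps_nth H i * fps_nth S (n - i)))"
    using unit(1) by (simp add: field_simps)
  also have "\<dots> \<in> R"
    by (intro mult_mem unit diff_mem HS sum_mem H less) auto
  finally show ?case .
qed

text \<open>The equation \<open>H' = H * S\<close> is a recursion for the coefficients of
  \<open>H\<close> that divides by the positive integers, so it is applied over the
  rationals.\<close>

lemma fps_of_log_deriv_mem: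
  assumes inv: "\<And>n. n > 0 \<Longrightarrow> inverse (of_nat n) \<in> R"
    and "fps_nth H 0 \<in> R" and S: "\<And>n. fps_nth S n \<in> R" and deriv: "fps_deriv H = H * S"
  shows "fps_nth H n \<in> R"
proof (induction n rule: less_induct)
  case (less n)
  show ?case
  proof (cases n)
    case 0
    with assms(2) show ?thesis by simp
  next
    case (Suc m)
    have "of_nat (Suc m) * fps_nth H (Suc m) = fps_nth (fps_deriv H) m"
      by simp
    also have "\<dots> = (\<Sum>i = 0..m. fps_nth H i * fps_nth S (m - i))"
      by (simp add: deriv fps_mult_nth)
    finally have "fps_nth H n = inverse (of_nat (Suc m)) * (\<Sum>i = 0..m. fps_nth H i * fps_nth S (m - i))"
      using Suc by (simp add: field_simps del: of_nat_Suc)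
    also have "\<dots> \<in> R"
      by (intro mult_mem inv sum_mem S less) (auto simp: Suc)
    finally show ?thesis .
  qed
qed

end

interpretation Rats: coefficient_ring "\<rat> :: 'a::field_char_0 set"
  by unfold_locales auto

interpretation Ints: coefficient_ring "\<int> :: 'a::field_char_0 set"
  by unfold_locales auto

section \<open>Newton's identities through logarithmic derivatives\<close>

definition power_sum :: "'a::comm_ring_1 list \<Rightarrow> nat \<Rightarrow> 'a" where
  "power_sum xs m = (\<Sum>x\<leftarrow>xs. x ^ m)"

lemma power_sum_Nil [simp]: "power_sum [] m = 0"
  and power_sum_Cons [simp]: "power_sum (x # xs) m = x ^ m + power_sum xs m"
  by (simp_all add: power_sum_def)

definition monic_with_roots :: "'a::comm_ring_1 list \<Rightarrow> 'a poly" where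
  "monic_with_roots xs = (\<Prod>x\<leftarrow>xs. [:- x, 1:])"

lemma monic_with_roots_Nil [simp]: "monic_with_roots [] = 1"
  and monic_with_roots_Cons [simp]: "monic_with_roots (x # xs) = [:- x, 1:] * monic_with_roots xs"
  by (simp_all add: monic_with_roots_def)

text \<open>The reversed polynomial with roots \<open>xs\<close>. Its constant term is 1, so as a
  power series it is invertible over every coefficient ring.\<close>

definition root_fps :: "'a::comm_ring_1 list \<Rightarrow> 'a fps" where
  "root_fps xs = (\<Prod>x\<leftarrow>xs. 1 - fps_const x * fps_X)"

lemma root_fps_Nil [simp]: "root_fps [] = 1"
  and root_fps_Cons [simp]: "root_fps (x # xs) = (1 - fps_const x * fps_X) * root_fps xs"
  by (simp_all add: root_fps_def)

lemma root_fps_nth_0 [simp]: "fps_nth (root_fps xs) 0 = 1"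
  by (induction xs) auto

lemma degree_monic_with_roots: "degree (monic_with_roots xs :: 'a::idom poly) = length xs"
proof -
  have "degree (monic_with_roots xs :: 'a poly) = length xs \<and> monic_with_roots xs \<noteq> (0 :: 'a poly)"
    by (induction xs) (auto simp: degree_mult_eq simp del: mult_pCons_left)
  thus ?thesis by blast
qed

lemma reflect_monic_with_roots:
  "fps_of_poly (reflect_poly (monic_with_roots xs)) = root_fps (xs :: 'a::field_char_0 list)"
proof (induction xs)
  case (Cons x xs)
  have "reflect_poly [:- x, 1:] = [:1, - x:]"
    by (simp add: reflect_poly_def)
  hence "fps_of_poly (reflect_poly [:- x, 1:]) = 1 - fps_const x * fps_X"
    by (simp add: fps_of_poly_pCons fps_const_neg[symmetric] del: fps_const_neg)
  with Cons show ?case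
    by (simp add: reflect_poly_mult fps_of_poly_mult del: mult_pCons_left)
qed simp

lemma (in coefficient_ring) coeff_monic_with_roots_mem_iff:
  "(\<forall>i. coeff (monic_with_roots xs) i \<in> R) \<longleftrightarrow> (\<forall>n. fps_nth (root_fps xs) n \<in> R)"
proof
  assume "\<forall>i. coeff (monic_with_roots xs) i \<in> R"
  thus "\<forall>n. fps_nth (root_fps xs) n \<in> R"
    by (auto simp: reflect_monic_with_roots[symmetric] coeff_reflect_poly)
next
  assume *: "\<forall>n. fps_nth (root_fps xs) n \<in> R"
  have "coeff (monic_with_roots xs) i \<in> R" for i
  proof (cases "i \<le> length xs")
    case True
    hence "coeff (monic_with_roots xs) i = fps_nth (root_fps xs) (length xs - i)"
      by (simp add: reflect_monic_with_roots[symmetric] coeff_reflect_poly degree_monic_with_roots)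
    with * show ?thesis by simp
  qed (simp add: degree_monic_with_roots coeff_eq_0)
  thus "\<forall>i. coeff (monic_with_roots xs) i \<in> R" by blast
qed

text \<open>Newton's identities in generating form: the logarithmic derivative of
  \<open>1 - x X\<close> is minus the geometric series with coefficients \<open>x ^ (m + 1)\<close>,
  and logarithmic derivatives of factors add up.\<close>

lemma fps_deriv_root_fps:
  "fps_deriv (root_fps xs) = root_fps xs * - Abs_fps (\<lambda>m. power_sum xs (Suc m))"
  for xs :: "'a::field_char_0 list"
proof (induction xs)
  case Nil
  show ?case by (simp add: fps_eq_iff)
next
  case (Cons x xs)
  let ?g = "Abs_fps (\<lambda>m. x ^ Suc m)" and ?s = "Abs_fps (\<lambda>m. power_sum xs (Suc m))"
  have geometric: "(1 - fps_const x * fps_X) * ?g = fps_const x"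
  proof (rule fps_ext)
    fix n show "fps_nth ((1 - fps_const x * fps_X) * ?g) n = fps_nth (fps_const x) n"
      by (cases n) (simp_all add: left_diff_distrib mult.assoc)
  qed
  have sum: "Abs_fps (\<lambda>m. power_sum (x # xs) (Suc m)) = ?g + ?s"
    by (simp add: fps_eq_iff)
  have "fps_deriv (root_fps (x # xs)) = - fps_const x * root_fps xs - (1 - fps_const x * fps_X) * root_fps xs * ?s"
    by (simp add: Cons algebra_simps fps_const_neg[symmetric] del: fps_const_neg)
  also have "\<dots> = - ((1 - fps_const x * fps_X) * ?g) * root_fps xs - (1 - fps_const x * fps_X) * root_fps xs * ?s"
    by (simp only: geometric)
  also have "\<dots> = root_fps (x # xs) * - (?g + ?s)"
    by (simp add: algebra_simps)
  finally show ?case by (simp only: sum)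
qed

context coefficient_ring
begin

text \<open>Newton's identities are solved for the power sums. Only the constant term 1 of
  \<open>root_fps xs\<close> is inverted, so this holds over the integers as well.\<close>

lemma power_sum_mem:
  assumes "\<And>n. fps_nth (root_fps xs) n \<in> R"
  shows "power_sum xs m \<in> R"
proof (cases m)
  case 0
  have "power_sum xs 0 = of_nat (length xs)"
    by (induction xs) auto
  with 0 show ?thesis by (simp add: of_nat_mem)
next
  case (Suc l)
  let ?S = "- Abs_fps (\<lambda>m. power_sum xs (Suc m))"
  have S: "fps_nth (root_fps xs * ?S) n \<in> R" for n
    unfolding fps_deriv_root_fps[symmetric] fps_deriv_nth
    by (intro mult_mem assms of_nat_mem)
  have "fps_nth ?S l \<in> R"
    by (rule fps_quotient_mem[OF assms _ _ S]) simp_all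
  with uminus_mem[of "fps_nth ?S l"] Suc show ?thesis by simp
qed

text \<open>Such a sum is a combination of power sums. This is the only consequence of the theory of
  symmetric functions that Hermite's argument needs.\<close>

lemma sum_roots_mem:
  assumes "\<And>i. coeff (monic_with_roots xs) i \<in> R" and "\<And>i. coeff h i \<in> R"
  shows "(\<Sum>x\<leftarrow>xs. poly h x) \<in> R"
proof -
  have "(\<Sum>x\<leftarrow>xs. poly h x) = (\<Sum>i\<le>degree h. coeff h i * power_sum xs i)"
    by (induction xs) (simp_all add: poly_altdef ring_distribs sum.distrib)
  also have "\<dots> \<in> R"
    using assms coeff_monic_with_roots_mem_iff[of xs] by (intro sum_mem mult_mem power_sum_mem) blast+
  finally show ?thesis .
qed

end

section \<open>Sums over sublists of the roots\<close>

fun subset_sums :: "'a::comm_ring_1 list \<Rightarrow> 'a list" where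
  "subset_sums [] = [0]"
| "subset_sums (x # xs) = subset_sums xs @ map ((+) x) (subset_sums xs)"

lemma zero_in_subset_sums: "0 \<in> set (subset_sums xs)"
  by (induction xs) auto

lemma sum_exp_subset_sums:
  "(\<Sum>y\<leftarrow>subset_sums xs. exp y) = (\<Prod>x\<leftarrow>xs. 1 + exp x)" for xs :: "complex list"
  by (induction xs) (simp_all add: o_def exp_add sum_list_const_mult algebra_simps)

lemma sum_fps_exp_subset_sums:
  "(\<Sum>y\<leftarrow>subset_sums xs. fps_exp y) = (\<Prod>x\<leftarrow>xs. 1 + fps_exp x)" for xs :: "complex list"
  by (induction xs) (simp_all add: o_def fps_exp_add_mult sum_list_const_mult algebra_simps)

text \<open>The logarithmic derivative of the exponential generating function of these power sums has the
  coefficients \<open>L_i * power_sum xs (i + 1)\<close>, where \<open>L\<close> is the rational series of \<open>exp / (1 + exp)\<close>.\<close>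

lemma power_sum_subset_sums_Rats:
  fixes xs :: "complex list"
  assumes "\<And>m. power_sum xs m \<in> \<rat>"
  shows "power_sum (subset_sums xs) m \<in> \<rat>"
proof -
  let ?H = "(\<Prod>x\<leftarrow>xs. 1 + fps_exp x) :: complex fps"
  have inverse_fact: "1 / fact n \<in> (\<rat> :: complex set)" for n
    using Rats_divide[OF Rats_1 Rats_of_nat[of "fact n"]] by simp
  define L :: "complex fps" where "L = inverse (1 + fps_exp 1) * fps_exp 1"
  have L: "(1 + fps_exp 1) * L = fps_exp 1"
    by (simp add: L_def mult.assoc[symmetric] inverse_mult_eq_1')
  have L_rat: "fps_nth L i \<in> \<rat>" for i
  proof (rule Rats.fps_quotient_mem[of "1 + fps_exp 1"])
    show "fps_nth ((1 + fps_exp 1) * L) n \<in> \<rat>" for n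
      unfolding L by (simp add: inverse_fact)
  qed (auto simp: fps_one_nth inverse_fact)
  \<comment> \<open>This is the defining identity of \<open>L\<close> with \<open>x X\<close>
    substituted for \<open>X\<close>, which multiplies each coefficient \<open>n\<close> by
    \<open>x ^ n\<close>.\<close>
  have scaled: "(1 + fps_exp x) * Abs_fps (\<lambda>i. x ^ i * fps_nth L i) = fps_exp x" for x
  proof (rule fps_ext)
    fix n
    have "fps_nth ((1 + fps_exp x) * Abs_fps (\<lambda>i. x ^ i * fps_nth L i)) n
        = (\<Sum>i=0..n. x ^ n * (fps_nth (1 + fps_exp 1) i * fps_nth L (n - i)))"
      unfolding fps_mult_nth
    proof (intro sum.cong refl)
      fix i assume "i \<in> {0..n}"
      hence "x ^ n = x ^ i * x ^ (n - i)"
        by (simp add: power_add[symmetric])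
      moreover have "fps_nth (1 + fps_exp x) i = x ^ i * fps_nth (1 + fps_exp 1) i"
        by (cases i) (simp_all add: fps_one_nth)
      ultimately show "fps_nth (1 + fps_exp x) i * fps_nth (Abs_fps (\<lambda>i. x ^ i * fps_nth L i)) (n - i)
          = x ^ n * (fps_nth (1 + fps_exp 1) i * fps_nth L (n - i))"
        by simp
    qed
    also have "\<dots> = x ^ n * fps_nth ((1 + fps_exp 1) * L) n"
      by (simp add: fps_mult_nth sum_distrib_left)
    finally show "fps_nth ((1 + fps_exp x) * Abs_fps (\<lambda>i. x ^ i * fps_nth L i)) n = fps_nth (fps_exp x) n"
      by (simp add: L)
  qed
  have deriv: "fps_deriv (\<Prod>x\<leftarrow>ys. 1 + fps_exp x) =
      (\<Prod>x\<leftarrow>ys. 1 + fps_exp x) * Abs_fps (\<lambda>i. fps_nth L i * power_sum ys (Suc i))" for ys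
  proof (induction ys)
    case Nil
    show ?case by (simp add: fps_eq_iff)
  next
    case (Cons y ys)
    let ?g = "Abs_fps (\<lambda>i. y ^ i * fps_nth L i)"
    have split: "Abs_fps (\<lambda>i. fps_nth L i * power_sum (y # ys) (Suc i))
        = fps_const y * ?g + Abs_fps (\<lambda>i. fps_nth L i * power_sum ys (Suc i))"
      by (simp add: fps_eq_iff algebra_simps)
    have "fps_deriv (\<Prod>x\<leftarrow>y # ys. 1 + fps_exp x) = fps_const y * fps_exp y * (\<Prod>x\<leftarrow>ys. 1 + fps_exp x)
        + (1 + fps_exp y) * ((\<Prod>x\<leftarrow>ys. 1 + fps_exp x) * Abs_fps (\<lambda>i. fps_nth L i * power_sum ys (Suc i)))"
      by (simp add: Cons algebra_simps)
    also have "\<dots> = fps_const y * ((1 + fps_exp y) * ?g) * (\<Prod>x\<leftarrow>ys. 1 + fps_exp x)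
        + (1 + fps_exp y) * ((\<Prod>x\<leftarrow>ys. 1 + fps_exp x) * Abs_fps (\<lambda>i. fps_nth L i * power_sum ys (Suc i)))"
      by (simp only: scaled)
    finally show ?case
      unfolding split by (simp add: algebra_simps)
  qed
  have "fps_nth ?H m \<in> \<rat>"
  proof (rule Rats.fps_of_log_deriv_mem[OF _ _ _ deriv])
    have "fps_nth ?H 0 = 2 ^ length xs"
      by (induction xs) auto
    thus "fps_nth ?H 0 \<in> \<rat>" by simp
    show "fps_nth (Abs_fps (\<lambda>i. fps_nth L i * power_sum xs (Suc i))) n \<in> \<rat>" for n
      using Rats_mult[OF L_rat assms] by simp
  qed auto
  moreover have "fps_nth (\<Sum>y\<leftarrow>ys. fps_exp y) m = power_sum ys m / fact m" for ys :: "complex list"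
    by (induction ys) (simp_all add: add_divide_distrib)
  ultimately have "power_sum (subset_sums xs) m / fact m \<in> \<rat>"
    by (simp only: sum_fps_exp_subset_sums[symmetric])
  hence "power_sum (subset_sums xs) m / fact m * of_nat (fact m) \<in> \<rat>"
    by (rule Rats_mult[OF _ Rats_of_nat])
  thus ?thesis by simp
qed

section \<open>Transcendence of \<open>\<pi>\<close>\<close>

text \<open>Each differentiation lowers the multiplicity of the root by at most one.\<close>

lemma higher_pderiv_root:
  fixes f :: "'a::{idom,semiring_char_0} poly"
  assumes "[:- a, 1:] ^ n dvd f" and "j < n"
  shows "poly ((pderiv ^^ j) f) a = 0"
  using assms
proof (induction j arbitrary: n f)
  case 0
  hence "[:- a, 1:] dvd f"
    by (meson dvd_power dvd_trans)
  thus ?case by (simp add: poly_eq_0_iff_dvd)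
next
  case (Suc j)
  then obtain m where n: "n = Suc m" by (cases n) auto
  obtain g where f: "f = [:- a, 1:] ^ Suc m * g"
    using Suc.prems n by (auto elim!: dvdE)
  have "[:- a, 1:] ^ m dvd pderiv f"
    unfolding f pderiv_mult pderiv_power_Suc
    by (intro dvd_add dvd_mult2[OF le_imp_power_dvd] dvd_mult[OF dvd_mult2[OF dvd_smult[OF dvd_refl]]]) simp
  from Suc.IH[OF this] Suc.prems n show ?case
    by (simp add: funpow_swap1)
qed

text \<open>Differentiating \<open>X ^ (i + j)\<close> exactly \<open>j\<close> times produces the
  factor \<open>(i + 1) ... (i + j)\<close>, which is \<open>j!\<close> times a binomial
  coefficient.\<close>

lemma higher_pderiv_Ints:
  fixes f :: "'a::field_char_0 poly"
  assumes "\<And>i. coeff f i \<in> \<int>"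
  obtains h where "\<And>i. coeff h i \<in> \<int>" "(pderiv ^^ j) f = smult (fact j) h"
proof
  let ?h = "smult (inverse (fact j)) ((pderiv ^^ j) f)"
  show "(pderiv ^^ j) f = smult (fact j) ?h" by simp
  fix i
  have "fact j dvd pochhammer (int (Suc i)) j"
    by (rule fact_dvd_pochhammer)
  then obtain c where "pochhammer (int (Suc i)) j = fact j * c" by (rule dvdE)
  hence "of_int (pochhammer (int (Suc i)) j) = (of_int (fact j * c) :: 'a)" by simp
  hence "pochhammer (of_nat (Suc i)) j = (fact j * of_int c :: 'a)"
    by (simp add: pochhammer_of_nat del: of_nat_Suc)
  hence "coeff ?h i = of_int c * coeff f (i + j)"
    by (simp add: coeff_higher_pderiv del: of_nat_Suc)
  thus "coeff ?h i \<in> \<int>" using assms by simp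
qed

text \<open>For \<open>F = hermite_sum b f\<close>, the derivative of \<open>exp (- u / b) * F u\<close> is \<open>- exp (- u / b) * f u / b\<close>.
  The scaling by \<open>b\<close> allows the exponents to be algebraic integers divided by \<open>b\<close>.\<close>

definition hermite_sum :: "nat \<Rightarrow> complex poly \<Rightarrow> complex \<Rightarrow> complex" where
  "hermite_sum b f u = (\<Sum>j\<le>degree f. of_nat b ^ j * poly ((pderiv ^^ j) f) u)"

lemma higher_pderiv_eq_0: "(pderiv ^^ Suc (degree f)) f = (0 :: complex poly)"
  by (intro poly_eqI) (simp add: coeff_higher_pderiv coeff_eq_0 del: funpow.simps)

lemma has_field_derivative_exp_hermite_sum:
  assumes "b > 0"
  shows "((\<lambda>u. exp (- u / of_nat b) * hermite_sum b f u) has_field_derivative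
           - exp (- u / of_nat b) * poly f u / of_nat b) (at u within S)"
proof -
  let ?F' = "\<Sum>j\<le>degree f. of_nat b ^ j * poly ((pderiv ^^ Suc j) f) u"
  have deriv: "(hermite_sum b f has_field_derivative ?F') (at u within S)"
    unfolding hermite_sum_def[abs_def]
    by (auto intro!: derivative_eq_intros sum.cong)
  \<comment> \<open>The sums telescope to \<open>F = f + b * F'\<close>, because the derivative of
    order \<open>degree f + 1\<close> vanishes.\<close>
  have "poly f u + of_nat b * ?F'
      = (\<Sum>j\<le>Suc (degree f). of_nat b ^ j * poly ((pderiv ^^ j) f) u)"
    by (subst sum.atMost_Suc_shift) (simp add: sum_distrib_left mult.assoc del: sum.atMost_Suc)
  also have "\<dots> = hermite_sum b f u"
    using higher_pderiv_eq_0[of f] by (simp add: hermite_sum_def)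
  finally have F: "hermite_sum b f u = poly f u + of_nat b * ?F'" by simp
  have e: "((\<lambda>u. exp (- u / of_nat b)) has_field_derivative exp (- u / of_nat b) * (- 1 / of_nat b)) (at u within S)"
    using assms by (auto intro!: derivative_eq_intros)
  have alg: "e * (- 1 / of_nat b) * (p + of_nat b * s) + s * e = - e * p / of_nat b" for e p s :: complex
    using assms by (simp add: field_simps)
  show ?thesis
    using DERIV_mult[OF e deriv] unfolding F alg .
qed

text \<open>The mean value inequality on the disc of radius \<open>r\<close> is applied to
  \<open>exp (- u / b) * F u\<close>. One factor \<open>exp r\<close> bounds its derivative, the
  other comes from multiplying by \<open>exp (x / b)\<close> afterwards.\<close>

lemma hermite_sum_bound:
  assumes "b > 0" and M: "\<And>u. norm u \<le> r \<Longrightarrow> norm (poly f u) \<le> M" and x: "norm x \<le> r"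
  shows "norm (hermite_sum b f x - exp (x / of_nat b) * hermite_sum b f 0) \<le> exp (2 * r) * r * M"
proof -
  have r: "r \<ge> 0" using x norm_ge_zero[of x] by linarith
  have M0: "M \<ge> 0" using order_trans[OF norm_ge_zero M[of 0]] r by simp
  have exp_bound: "norm (exp (u / of_nat b)) \<le> exp r" if "norm u \<le> r" for u :: complex
  proof -
    have "norm (exp (u / of_nat b)) \<le> exp (norm (u / of_nat b))" by (rule norm_exp)
    also have "norm (u / of_nat b) \<le> norm u / 1"
      unfolding norm_divide using assms(1) by (intro divide_left_mono) auto
    finally show ?thesis using that by (simp add: order_trans)
  qed
  let ?G = "\<lambda>u. exp (- u / of_nat b) * hermite_sum b f u"
  have "norm (?G x - ?G 0) \<le> (exp r * M) * norm (x - 0)"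
  proof (rule field_differentiable_bound[of "cball 0 r"])
    fix u :: complex assume u: "u \<in> cball 0 r"
    have "norm (- exp (- u / of_nat b) * poly f u / of_nat b) \<le> norm (exp (- u / of_nat b)) * norm (poly f u) / 1"
      unfolding norm_divide norm_mult norm_minus_cancel using assms(1)
      by (intro divide_left_mono) (auto intro: mult_nonneg_nonneg)
    also have "\<dots> \<le> exp r * M"
      using u exp_bound[of "- u"] M[of u] by (auto intro!: mult_mono)
    finally show "norm (- exp (- u / of_nat b) * poly f u / of_nat b) \<le> exp r * M" .
    show "(?G has_field_derivative - exp (- u / of_nat b) * poly f u / of_nat b) (at u within cball 0 r)"
      by (rule has_field_derivative_exp_hermite_sum[OF assms(1)])
  qed (use x r in auto)
  also have "\<dots> \<le> (exp r * M) * r"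
    using x M0 by (intro mult_left_mono) auto
  finally have G: "norm (?G x - ?G 0) \<le> exp r * M * r" .
  have "exp (x / of_nat b) * exp (- x / of_nat b) = 1"
    by (simp add: exp_add[symmetric])
  hence "hermite_sum b f x - exp (x / of_nat b) * hermite_sum b f 0 = exp (x / of_nat b) * (?G x - ?G 0)"
    by (simp add: right_diff_distrib mult.assoc[symmetric])
  hence "norm (hermite_sum b f x - exp (x / of_nat b) * hermite_sum b f 0) = norm (exp (x / of_nat b)) * norm (?G x - ?G 0)"
    by (simp add: norm_mult)
  also have "\<dots> \<le> exp r * (exp r * M * r)"
    using exp_bound[OF x] G by (intro mult_mono) auto
  also have "\<dots> = exp (2 * r) * r * M"
    by (simp add: mult_exp_exp)
  finally show ?thesis .
qed

lemma poly_monic_with_roots: "poly (monic_with_roots xs) u = (\<Prod>x\<leftarrow>xs. u - x)"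
  by (induction xs) (auto simp: algebra_simps)

lemma root_dvd_monic_with_roots: "x \<in> set xs \<Longrightarrow> [:- x, 1:] dvd monic_with_roots xs"
  by (induction xs) (auto simp del: mult_pCons_left)

lemma norm_poly_monic_with_roots_le:
  fixes xs :: "complex list"
  assumes "\<And>x. x \<in> set xs \<Longrightarrow> norm x \<le> r" and "norm u \<le> r"
  shows "norm (poly (monic_with_roots xs) u) \<le> (2 * r) ^ length xs"
  using assms(1)
proof (induction xs)
  case (Cons x xs)
  have "norm (u - x) \<le> 2 * r"
    using norm_triangle_ineq4[of u x] assms(2) Cons.prems[of x] by simp
  moreover have "norm (poly (monic_with_roots xs) u) \<le> (2 * r) ^ length xs"
    using Cons by simp
  moreover have "r \<ge> 0" using assms(2) norm_ge_zero[of u] by linarith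
  ultimately have "norm (u - x) * norm (poly (monic_with_roots xs) u) \<le> 2 * r * (2 * r) ^ length xs"
    by (intro mult_mono) auto
  thus ?case
    by (simp only: poly_monic_with_roots list.map prod_list.Cons norm_mult length_Cons power_Suc)
qed simp

section \<open>Arithmetic and size of Hermite's sums\<close>

lemma Ints_coeff_mult:
  "(\<And>i. coeff f i \<in> \<int>) \<Longrightarrow> (\<And>i. coeff g i \<in> \<int>) \<Longrightarrow> coeff (f * g) i \<in> \<int>"
  for f g :: "'a::comm_ring_1 poly"
  by (auto simp: coeff_mult intro!: Ints.sum_mem)

lemma Ints_coeff_power: "(\<And>i. coeff f i \<in> \<int>) \<Longrightarrow> coeff (f ^ n) i \<in> \<int>"
  for f :: "'a::comm_ring_1 poly"
  by (induction n arbitrary: i) (auto intro: Ints_coeff_mult)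

lemma fact_eq_mult_fact_Ints:
  assumes "m \<le> n"
  obtains c where "c \<in> \<int>" "fact n = fact m * (c :: 'a::field_char_0)"
proof -
  have "(fact m :: nat) dvd fact n" using assms by (rule fact_dvd)
  then obtain d :: nat where "fact n = fact m * d" by (rule dvdE)
  hence "of_nat (fact n) = (of_nat (fact m * d) :: 'a)" by (simp only:)
  hence "fact n = fact m * (of_nat d :: 'a)" by simp
  thus thesis by (intro that[of "of_nat d"]) auto
qed

text \<open>At 0 the factor \<open>X ^ (p - 1)\<close> kills the derivatives of order below
  \<open>p - 1\<close>, order \<open>p - 1\<close> gives \<open>(p - 1)! * G 0 ^ p\<close>, and all
  higher orders are divisible by \<open>p!\<close>. Only one term may thus escape divisibility by
  \<open>p!\<close>.\<close>

lemma hermite_sum_0_decomp: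
  fixes G :: "complex poly"
  assumes G: "\<And>i. coeff G i \<in> \<int>" and p: "p > 0"
  obtains A where "A \<in> \<int>"
    "hermite_sum b (monom 1 (p - 1) * G ^ p) 0 = fact (p - 1) * (of_nat b ^ (p - 1) * poly G 0 ^ p + of_nat p * A)"
proof -
  let ?f = "monom 1 (p - 1) * G ^ p"
  have f: "coeff ?f i \<in> \<int>" for i
    by (intro Ints_coeff_mult Ints_coeff_power G) auto
  have term0: "poly ((pderiv ^^ j) ?f) 0 = fact j * coeff ?f j" for j
    by (simp add: poly_0_coeff_0 coeff_higher_pderiv pochhammer_fact[symmetric] of_nat_Suc[symmetric] del: of_nat_Suc)
       (simp add: pochhammer_fact)
  define T where "T j = of_nat b ^ j * poly ((pderiv ^^ j) ?f) 0" for j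
  have low: "T j = 0" if "j < p - 1" for j
    using that by (simp add: T_def term0 coeff_monom_mult del: One_nat_def)
  have mid: "T (p - 1) = fact (p - 1) * (of_nat b ^ (p - 1) * poly G 0 ^ p)"
    by (simp add: T_def term0 coeff_monom_mult poly_0_coeff_0[symmetric] poly_power del: One_nat_def)
  have high: "\<exists>c\<in>\<int>. T j = fact p * c" if j: "p \<le> j" for j
  proof -
    obtain c :: complex where c: "c \<in> \<int>" "fact j = fact p * c" using fact_eq_mult_fact_Ints[OF j] .
    have "T j = fact p * (c * of_nat b ^ j * coeff ?f j)" by (simp add: T_def term0 c(2) del: One_nat_def)
    moreover have "c * of_nat b ^ j * coeff ?f j \<in> \<int>" using c f by (intro Ints_mult) auto
    ultimately show ?thesis by blast
  qed
  then obtain c where c: "\<And>j. p \<le> j \<Longrightarrow> c j \<in> \<int> \<and> T j = fact p * c j" by metis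
  \<comment> \<open>The range is extended to at least \<open>p\<close> so that it splits at
    \<open>p - 1\<close> even if \<open>G\<close> is constant; the added derivatives are
    zero.\<close>
  define n where "n = max (degree ?f) p"
  have "hermite_sum b ?f 0 = (\<Sum>j\<le>degree ?f. T j)" by (simp add: hermite_sum_def T_def)
  also have "\<dots> = (\<Sum>j\<le>n. T j)"
    by (rule sum.mono_neutral_left) (auto simp: n_def T_def term0 coeff_eq_0 simp del: One_nat_def)
  also have "{..n} = {..<p - 1} \<union> {p - 1} \<union> {p..n}" using p by (auto simp: n_def)
  also have "sum T \<dots> = sum T {..<p - 1} + T (p - 1) + sum T {p..n}"
    using p by (subst sum.union_disjoint; (simp; fail)?) (auto simp: sum.union_disjoint)
  also have "sum T {..<p - 1} = 0" using low by simp
  also have "sum T {p..n} = fact p * (\<Sum>j=p..n. c j)"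
    using c by (simp add: sum_distrib_left)
  also have "fact p = fact (p - 1) * (of_nat p :: complex)"
    using p by (simp add: fact_reduce mult.commute)
  finally have "hermite_sum b ?f 0 = fact (p - 1) * (of_nat b ^ (p - 1) * poly G 0 ^ p + of_nat p * (\<Sum>j=p..n. c j))"
    using mid by (simp add: algebra_simps)
  thus thesis using c by (intro that[of "\<Sum>j=p..n. c j"] Ints.sum_mem) auto
qed

text \<open>Every root has multiplicity at least \<open>p\<close>, so derivatives of order below
  \<open>p\<close> vanish there. From order \<open>p\<close> on a factor \<open>p!\<close> splits
  off, and what remains is an integer because it is symmetric in the roots.\<close>

lemma sum_hermite_sum_roots:
  fixes xs :: "complex list"
  assumes G: "\<And>i. coeff (monic_with_roots xs) i \<in> \<int>"
  obtains B where "B \<in> \<int>"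
    "(\<Sum>x\<leftarrow>xs. hermite_sum b (monom 1 (p - 1) * monic_with_roots xs ^ p) x) = fact p * B"
proof -
  let ?f = "monom 1 (p - 1) * monic_with_roots xs ^ p"
  have f: "coeff ?f i \<in> \<int>" for i
    by (intro Ints_coeff_mult Ints_coeff_power G) auto
  have "\<exists>c\<in>\<int>. (\<Sum>x\<leftarrow>xs. poly ((pderiv ^^ j) ?f) x) = fact p * c" for j
  proof (cases "j < p")
    case True
    have "poly ((pderiv ^^ j) ?f) x = 0" if "x \<in> set xs" for x
      using root_dvd_monic_with_roots[OF that]
      by (intro higher_pderiv_root[OF _ True]) (auto intro: dvd_mult dvd_power_same)
    hence "(\<Sum>x\<leftarrow>xs. poly ((pderiv ^^ j) ?f) x) = (\<Sum>x\<leftarrow>xs. 0)"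
      by (intro arg_cong[where f = sum_list] map_cong refl)
    thus ?thesis by (intro bexI[of _ 0]) auto
  next
    case False
    then obtain c :: complex where c: "c \<in> \<int>" "fact j = fact p * c"
      using fact_eq_mult_fact_Ints[of p j] by (metis not_less)
    obtain h where h: "\<And>i. coeff h i \<in> \<int>" "(pderiv ^^ j) ?f = smult (fact j) h"
      using higher_pderiv_Ints[OF f] by blast
    have "(\<Sum>x\<leftarrow>xs. poly ((pderiv ^^ j) ?f) x) = fact p * (c * (\<Sum>x\<leftarrow>xs. poly h x))"
      unfolding h(2) by (simp add: sum_list_const_mult c(2) mult.assoc)
    thus ?thesis using Ints.sum_roots_mem[OF G h(1)] c(1) by (intro bexI[of _ "c * (\<Sum>x\<leftarrow>xs. poly h x)"]) auto
  qed
  then obtain c where c: "\<And>j. c j \<in> \<int>" "\<And>j. (\<Sum>x\<leftarrow>xs. poly ((pderiv ^^ j) ?f) x) = fact p * c j" by metis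
  have "(\<Sum>x\<leftarrow>ys. hermite_sum b ?f x) = (\<Sum>j\<le>degree ?f. of_nat b ^ j * (\<Sum>x\<leftarrow>ys. poly ((pderiv ^^ j) ?f) x))" for ys
    by (induction ys) (simp_all add: hermite_sum_def sum.distrib ring_distribs)
  also have "(\<Sum>j\<le>degree ?f. of_nat b ^ j * (\<Sum>x\<leftarrow>xs. poly ((pderiv ^^ j) ?f) x)) = fact p * (\<Sum>j\<le>degree ?f. of_nat b ^ j * c j)"
    unfolding c(2) sum_distrib_left by (intro sum.cong) auto
  finally have "(\<Sum>x\<leftarrow>xs. hermite_sum b ?f x) = fact p * (\<Sum>j\<le>degree ?f. of_nat b ^ j * c j)" .
  thus thesis using c(1) by (intro that Ints.sum_mem) auto
qed

lemma norm_sum_list_le: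
  fixes f :: "'a \<Rightarrow> 'b::real_normed_vector" and c :: real
  assumes "\<And>x. x \<in> set xs \<Longrightarrow> norm (f x) \<le> c"
  shows "norm (\<Sum>x\<leftarrow>xs. f x) \<le> length xs * c"
  using assms
proof (induction xs)
  case (Cons x xs)
  have "norm (f x + (\<Sum>x\<leftarrow>xs. f x)) \<le> norm (f x) + norm (\<Sum>x\<leftarrow>xs. f x)"
    by (rule norm_triangle_ineq)
  also have "\<dots> \<le> c + length xs * c"
    using Cons by (intro add_mono) auto
  finally show ?case by (simp add: algebra_simps)
qed simp

lemma ex_prime_fact_gt_power:
  "\<exists>p. prime p \<and> p > m \<and> K * C ^ p < fact (p - 1)" for K C :: real
proof -
  \<comment> \<open>Factorials outgrow exponentials. The extra \<open>C\<close> accounts for the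
    factorial having argument \<open>p - 1\<close> while the power has exponent
    \<open>p\<close>.\<close>
  have "(\<lambda>n. K * C * (inverse (fact n) * C ^ n)) \<longlonglongrightarrow> K * C * 0"
    by (intro tendsto_mult tendsto_const summable_LIMSEQ_zero summable_exp)
  hence "eventually (\<lambda>n. K * C * (inverse (fact n) * C ^ n) < 1) sequentially"
    by (intro order_tendstoD) auto
  then obtain n0 where n0: "\<And>n. n \<ge> n0 \<Longrightarrow> K * C * (inverse (fact n) * C ^ n) < 1"
    by (auto simp: eventually_sequentially)
  obtain p where p: "prime p" "p > max m n0" using bigger_prime by blast
  hence "K * C * (inverse (fact (p - 1)) * C ^ (p - 1)) < 1" by (intro n0) auto
  moreover have "C ^ p = C * C ^ (p - 1)" using p by (cases p) auto
  ultimately have "K * C ^ p < fact (p - 1)"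
    by (simp add: field_simps)
  with p show ?thesis by auto
qed

text \<open>If the sum vanished, the exponentials could be eliminated from the Hermite
  approximations. This leaves \<open>(p - 1)!\<close> times an integer that is nonzero modulo
  \<open>p\<close>, yet of size at most \<open>K * C ^ p\<close>, which is impossible for a large
  prime \<open>p\<close>.\<close>

lemma exp_sum_roots_nonzero:
  fixes xs :: "complex list"
  assumes "b > 0" "N > 0" and nonzero: "0 \<notin> set xs"
    and G: "\<And>i. coeff (monic_with_roots xs) i \<in> \<int>"
  shows "of_nat N + (\<Sum>x\<leftarrow>xs. exp (x / of_nat b)) \<noteq> 0"
proof
  assume zero: "of_nat N + (\<Sum>x\<leftarrow>xs. exp (x / of_nat b)) = 0"
  \<comment> \<open>Inserting 1 covers the empty list and gives \<open>r \<ge> 1\<close>, so that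
    \<open>r ^ (p - 1)\<close> may later be enlarged to \<open>r ^ p\<close>.\<close>
  define r where "r = Max (insert 1 (norm ` set xs))"
  have r: "1 \<le> r" "\<And>x. x \<in> set xs \<Longrightarrow> norm x \<le> r"
    by (auto simp: r_def)
  define C where "C = r * (2 * r) ^ length xs"
  define K where "K = length xs * (exp (2 * r) * r)"
  have "poly (monic_with_roots xs) 0 \<in> \<int>" using G by (simp add: poly_0_coeff_0)
  then obtain g :: int where g: "poly (monic_with_roots xs) 0 = of_int g" by (rule Ints_cases)
  have "g \<noteq> 0"
  proof
    assume "g = 0"
    hence "(\<Prod>x\<leftarrow>xs. - x) = 0" using g by (simp add: poly_monic_with_roots)
    thus False using nonzero by (auto simp: prod_list_zero_iff)
  qed
  \<comment> \<open>A prime above \<open>N\<close>, \<open>b\<close> and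
    \<open>\<bar>g\<bar>\<close> divides none of them, which makes \<open>I\<close> below
    nonzero.\<close>
  obtain p where p: "prime p" "p > max N (max b (nat \<bar>g\<bar>))" "K * C ^ p < fact (p - 1)"
    using ex_prime_fact_gt_power by blast
  have p0: "p > 0" using p(1) by (rule prime_gt_0_nat)
  define f where "f = monom 1 (p - 1) * monic_with_roots xs ^ p"
  let ?F = "hermite_sum b f"
  obtain A where A: "A \<in> \<int>" "?F 0 = fact (p - 1) * (of_nat b ^ (p - 1) * of_int g ^ p + of_nat p * A)"
    unfolding f_def g[symmetric] by (rule hermite_sum_0_decomp[OF G p0])
  obtain B where B: "B \<in> \<int>" "(\<Sum>x\<leftarrow>xs. ?F x) = fact p * B"
    unfolding f_def by (rule sum_hermite_sum_roots[OF G])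
  \<comment> \<open>\<open>J\<close> collects the approximation errors: small by
    \<open>hermite_sum_bound\<close>, and after substitution of the assumed relation free of
    exponentials.\<close>
  define J where "J = (\<Sum>x\<leftarrow>xs. ?F x - exp (x / of_nat b) * ?F 0)"
  have "J = (\<Sum>x\<leftarrow>xs. ?F x) - (\<Sum>x\<leftarrow>xs. exp (x / of_nat b)) * ?F 0"
    unfolding J_def by (simp add: sum_list_subtractf sum_list_mult_const)
  also have "(\<Sum>x\<leftarrow>xs. exp (x / of_nat b)) = - of_nat N"
    using zero by (simp add: eq_neg_iff_add_eq_0 add.commute)
  finally have J': "J = (\<Sum>x\<leftarrow>xs. ?F x) - - of_nat N * ?F 0" .
  have "fact p = fact (p - 1) * (of_nat p :: complex)"
    using p0 by (simp add: fact_reduce mult.commute)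
  hence J: "J = fact (p - 1) *
      (of_nat N * of_nat b ^ (p - 1) * of_int g ^ p + of_nat p * (of_nat N * A + B))"
    unfolding J' A B by (simp add: algebra_simps)
  obtain c :: int where c: "of_nat N * A + B = of_int c"
    using A B by (metis Ints_add Ints_mult Ints_of_nat Ints_cases)
  define I where "I = int N * int b ^ (p - 1) * g ^ p + int p * c"
  have "J = fact (p - 1) * of_int I"
    unfolding J c I_def by simp
  hence norm_J: "norm J = fact (p - 1) * of_int \<bar>I\<bar>" by (simp add: norm_mult)
  have "I \<noteq> 0"
  proof
    assume "I = 0"
    hence "int p dvd int N * int b ^ (p - 1) * g ^ p"
      unfolding I_def by (metis dvd_triv_left dvd_add_left_iff dvd_0_right)
    moreover have ip: "prime (int p)" using p(1) by simp
    ultimately have "(int p dvd int N \<or> int p dvd int b ^ (p - 1)) \<or> int p dvd g ^ p"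
      by (simp only: prime_dvd_mult_iff)
    hence "int p dvd int N \<or> int p dvd int b \<or> int p dvd g"
      using prime_dvd_power[OF ip] by blast
    hence "int p \<le> int N \<or> int p \<le> int b \<or> int p \<le> \<bar>g\<bar>"
      using dvd_imp_le_int[of "int N" "int p"] dvd_imp_le_int[of "int b" "int p"]
        dvd_imp_le_int[of g "int p"] assms(1,2) \<open>g \<noteq> 0\<close> by force
    thus False using p(2) by linarith
  qed
  hence "fact (p - 1) \<le> norm J"
    unfolding norm_J by (simp add: mult_le_cancel_left1)
  also have "norm J \<le> length xs * (exp (2 * r) * r * C ^ p)"
    unfolding J_def
  proof (rule norm_sum_list_le, rule hermite_sum_bound)
    fix u :: complex assume u: "norm u \<le> r"
    have "norm (poly f u) = norm u ^ (p - 1) * norm (poly (monic_with_roots xs) u) ^ p"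
      by (simp add: f_def poly_monom poly_power norm_mult norm_power)
    also have "\<dots> \<le> r ^ (p - 1) * ((2 * r) ^ length xs) ^ p"
      using u r norm_poly_monic_with_roots_le[OF r(2) u] by (intro mult_mono power_mono) auto
    also have "\<dots> \<le> r ^ p * ((2 * r) ^ length xs) ^ p"
      using r(1) by (intro mult_right_mono power_increasing) auto
    finally show "norm (poly f u) \<le> C ^ p" by (simp add: C_def power_mult_distrib)
  qed (use r assms in auto)
  also have "\<dots> = K * C ^ p" by (simp add: K_def)
  finally show False using p(3) by simp
qed

section \<open>Clearing denominators, and the transcendence of \<open>pi * i\<close>\<close>

lemma common_denominator:
  fixes f :: "'a \<Rightarrow> 'b::field_char_0"
  assumes "finite A" "\<And>a. a \<in> A \<Longrightarrow> f a \<in> \<rat>"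
  obtains b :: nat where "b > 0" "\<And>a. a \<in> A \<Longrightarrow> of_nat b * f a \<in> \<int>"
proof -
  have "\<exists>b::nat. b > 0 \<and> (\<forall>a\<in>A. of_nat b * f a \<in> \<int>)"
    using assms
  proof (induction A rule: finite_induct)
    case (insert a A)
    then obtain b :: nat where b: "b > 0" "\<And>a. a \<in> A \<Longrightarrow> of_nat b * f a \<in> \<int>" by auto
    have "f a \<in> \<rat>" using insert by auto
    then obtain m n :: int where mn: "n > 0" "f a = of_int m / of_int n" by (rule Rats_cases')
    have n: "of_nat (nat n) = (of_int n :: 'b)" using mn(1) by simp
    have "of_nat (b * nat n) * f a = of_int (int b * m)"
      using mn by (simp add: n)
    hence "of_nat (b * nat n) * f a \<in> \<int>" by (simp only: Ints_of_int)
    moreover have "of_nat (b * nat n) * f a' \<in> \<int>" if "a' \<in> A" for a'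
      using Ints_mult[OF Ints_of_nat[of "nat n"] b(2)[OF that]] by (simp add: mult_ac)
    ultimately show ?case
      using b(1) mn(1) by (intro exI[of _ "b * nat n"]) (auto simp del: of_nat_mult)
  qed auto
  thus thesis using that by blast
qed

text \<open>Scaling all roots by a common denominator of the coefficients makes the coefficients
  integral, since coefficient \<open>n\<close> gains the factor \<open>c ^ n\<close> and coefficient
  0 is already 1.\<close>

lemma root_fps_scale:
  "fps_nth (root_fps (map ((*) c) xs)) n = c ^ n * fps_nth (root_fps xs) n"
  for c :: "'a::field_char_0"
proof (induction xs arbitrary: n)
  case (Cons x xs)
  show ?case
    by (cases n) (simp_all add: Cons left_diff_distrib right_diff_distrib mult.assoc mult.left_commute)
qed simp

text \<open>Among the roots \<open>x\<close> of an integral polynomial vanishing at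
  \<open>pi * i\<close>, the factor \<open>1 + exp (pi * i)\<close> makes the product of all
  \<open>1 + exp x\<close> vanish. Expanded, the product is a vanishing sum of exponentials of
  subset sums, to which \<open>exp_sum_roots_nonzero\<close> applies.\<close>

theorem not_algebraic_ii_pi: "\<not> algebraic (\<i> * of_real pi)"
proof
  assume "algebraic (\<i> * of_real pi)"
  then obtain P where P: "\<And>i. coeff P i \<in> \<int>" "P \<noteq> 0" "poly P (\<i> * of_real pi) = 0"
    by (rule algebraicE) blast
  obtain M where "P = smult (coeff P (degree P)) (\<Prod>x\<in>#M. [:- x, 1:])"
    using alg_closed_imp_factorization[OF P(2)] by blast
  moreover obtain xs where "mset xs = M" using ex_mset by blast
  ultimately have xs: "P = smult (coeff P (degree P)) (monic_with_roots xs)"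
    by (auto simp: monic_with_roots_def prod_mset_prod_list[symmetric] simp flip: mset_map)
  have "coeff (monic_with_roots xs) i \<in> \<rat>" for i
  proof -
    have "coeff P i / coeff P (degree P) \<in> \<rat>" using P(1) Ints_subset_Rats by (intro Rats_divide) auto
    moreover have "coeff P i = coeff P (degree P) * coeff (monic_with_roots xs) i"
      by (subst xs) simp
    ultimately show ?thesis using P(2) by simp
  qed
  hence power_sums: "power_sum xs m \<in> \<rat>" for m
    using Rats.coeff_monic_with_roots_mem_iff[of xs] by (intro Rats.power_sum_mem) blast
  have "poly (monic_with_roots xs) (\<i> * of_real pi) = 0"
    using P(2,3) by (subst (asm) xs) simp
  hence root: "\<i> * of_real pi \<in> set xs"
    by (auto simp: poly_monic_with_roots prod_list_zero_iff)
  \<comment> \<open>Vanishing subset sums contribute the integer \<open>N\<close>, which is positive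
    because of the empty sum.\<close>
  define ys where "ys = filter (\<lambda>y. y \<noteq> 0) (subset_sums xs)"
  define N where "N = length (filter (\<lambda>y. y = 0) (subset_sums xs))"
  have "N > 0" using zero_in_subset_sums[of xs] by (auto simp: N_def filter_empty_conv)
  have "of_nat N + (\<Sum>y\<leftarrow>ys. exp y) = (\<Sum>y\<leftarrow>subset_sums xs. exp y)"
  proof -
    have "of_nat (length (filter (\<lambda>y. y = 0) zs)) + (\<Sum>y\<leftarrow>filter (\<lambda>y. y \<noteq> 0) zs. exp y) = (\<Sum>y\<leftarrow>zs. exp y)"
      for zs :: "complex list" by (induction zs) auto
    thus ?thesis by (simp add: N_def ys_def)
  qed
  also have "\<dots> = 0"
    unfolding sum_exp_subset_sums prod_list_zero_iff
    using root by (force simp: image_iff)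
  finally have zero: "of_nat N + (\<Sum>y\<leftarrow>ys. exp y) = 0" .
  \<comment> \<open>Dropping zeros leaves the power sums of positive order unchanged, and only these
    enter the logarithmic derivative of \<open>root_fps ys\<close>.\<close>
  have "power_sum ys (Suc m) = power_sum (subset_sums xs) (Suc m)" for m
  proof -
    have "power_sum (filter (\<lambda>y. y \<noteq> 0) zs) (Suc m) = power_sum zs (Suc m)" for zs :: "complex list"
      by (induction zs) auto
    thus ?thesis by (simp add: ys_def)
  qed
  hence S: "fps_nth (- Abs_fps (\<lambda>m. power_sum ys (Suc m))) n \<in> \<rat>" for n
    using power_sum_subset_sums_Rats[OF power_sums] by simp
  have rat: "fps_nth (root_fps ys) n \<in> \<rat>" for n
    by (rule Rats.fps_of_log_deriv_mem[OF _ _ S fps_deriv_root_fps]) simp_all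
  obtain b :: nat where b: "b > 0" "\<And>n. n \<le> length ys \<Longrightarrow> of_nat b * fps_nth (root_fps ys) n \<in> \<int>"
    using common_denominator[of "{..length ys}" "fps_nth (root_fps ys)"] rat by auto
  let ?zs = "map ((*) (of_nat b)) ys"
  have "fps_nth (root_fps ?zs) n \<in> \<int>" for n
  proof (cases n)
    case (Suc m)
    show ?thesis
    proof (cases "n \<le> length ys")
      case True
      from Ints_mult[OF _ b(2)[OF this], of "of_nat b ^ m"] show ?thesis
        by (simp add: root_fps_scale Suc mult_ac)
    next
      case False
      thus ?thesis
        by (simp add: reflect_monic_with_roots[symmetric] coeff_reflect_poly degree_monic_with_roots)
    qed
  qed simp
  hence "coeff (monic_with_roots ?zs) i \<in> \<int>" for i
    using Ints.coeff_monic_with_roots_mem_iff[of ?zs] by blast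
  moreover have "0 \<notin> set ?zs" using b(1) by (auto simp: ys_def)
  ultimately have "of_nat N + (\<Sum>z\<leftarrow>?zs. exp (z / of_nat b)) \<noteq> 0"
    using \<open>N > 0\<close> b(1) by (intro exp_sum_roots_nonzero)
  thus False using zero b(1) by (simp add: o_def)
qed

section \<open>Integral equations of roots of unity\<close>

definition int_eval :: "int poly \<Rightarrow> 'a::comm_ring_1 \<Rightarrow> 'a" where
  "int_eval F z = poly (map_poly of_int F) z"

lemma int_eval_0 [simp]: "int_eval 0 z = 0"
  and int_eval_pCons [simp]: "int_eval (pCons a F) z = of_int a + z * int_eval F z"
  by (simp_all add: int_eval_def map_poly_pCons)

lemma int_eval_1 [simp]: "int_eval 1 z = 1"
  by (simp add: one_pCons)

lemma int_eval_add [simp]: "int_eval (F + G) z = int_eval F z + int_eval G z"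
  by (induction F G rule: poly_induct2) (simp_all add: algebra_simps)

lemma int_eval_smult [simp]: "int_eval (smult c F) z = of_int c * int_eval F z"
  by (induction F) (simp_all add: algebra_simps)

lemma int_eval_diff [simp]: "int_eval (F - G) z = int_eval F z - int_eval G z"
proof -
  have "F - G = F + smult (- 1) G" by simp
  thus ?thesis by (simp only: int_eval_add int_eval_smult) simp
qed

lemma int_eval_mult [simp]: "int_eval (F * G) z = int_eval F z * int_eval G z"
  by (induction F) (simp_all add: algebra_simps)

lemma int_eval_power [simp]: "int_eval (F ^ n) z = int_eval F z ^ n"
  by (induction n) simp_all

lemma int_eval_pcompose [simp]: "int_eval (pcompose F G) z = int_eval F (int_eval G z)"
  by (induction F) (simp_all add: pcompose_pCons)

lemma int_eval_monom [simp]: "int_eval (monom c n) z = of_int c * z ^ n"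
  by (induction n) (simp_all add: monom_0 monom_Suc algebra_simps)

lemma int_eval_sum [simp]: "int_eval (\<Sum>i\<in>A. F i) z = (\<Sum>i\<in>A. int_eval (F i) z)"
  by (induction A rule: infinite_finite_induct) simp_all

lemma int_eval_prod [simp]: "int_eval (\<Prod>i\<in>A. F i) z = (\<Prod>i\<in>A. int_eval (F i) z)"
  by (induction A rule: infinite_finite_induct) simp_all

lemma int_eval_prod_mset [simp]: "int_eval (prod_mset A) z = (\<Prod>F\<in>#A. int_eval F z)"
  by (induction A) simp_all

text \<open>Descent on \<open>degree r\<close>: the pseudo-remainder of \<open>f\<close> by
  \<open>r\<close> also vanishes at \<open>z\<close>, hence is 0. As \<open>f\<close> is prime and
  too large to divide \<open>r\<close>, it divides the cofactor, which leaves a constant for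
  \<open>r\<close>. Thus \<open>f\<close> plays the part of a minimal polynomial.\<close>

lemma prime_elem_root_degree_le:
  fixes f :: "int poly" and z :: "'a::field_char_0"
  assumes f: "prime_elem f" "int_eval f z = 0" and r: "r \<noteq> 0" "int_eval r z = 0"
  shows "degree f \<le> degree r"
proof (rule ccontr)
  assume "\<not> degree f \<le> degree r"
  with r show False
  proof (induction "degree r" arbitrary: r rule: less_induct)
    case less
    obtain a q where aq: "a \<noteq> 0" "smult a f = r * q + pseudo_mod f r"
      using pseudo_mod(1)[OF less.prems(1)] by blast
    have "int_eval (pseudo_mod f r) z = 0"
      using arg_cong[OF aq(2), of "\<lambda>F. int_eval F z"] f less.prems by simp
    with less.hyps[of "pseudo_mod f r"] less.prems pseudo_mod(2)[OF less.prems(1), of f]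
    have "pseudo_mod f r = 0" by auto
    hence eq: "smult a f = r * q" using aq by simp
    hence "f dvd r * q" by (metis dvd_refl dvd_smult)
    hence "f dvd r \<or> f dvd q" using f(1) by (simp add: prime_elem_dvd_mult_iff)
    moreover have "\<not> f dvd r"
      using less.prems by (auto dest: dvd_imp_degree_le)
    ultimately obtain s where "q = f * s" by (auto elim: dvdE)
    with eq have "f * [:a:] = f * (r * s)" by (simp add: mult_ac)
    moreover have "f \<noteq> 0" using f(1) by auto
    ultimately have "[:a:] = r * s" using mult_left_cancel by blast
    moreover from this have "s \<noteq> 0" using aq(1) by auto
    ultimately have "degree r = 0"
      using less.prems(1) degree_mult_eq[of r s] by (metis add_is_0 degree_pCons_0)
    then obtain c where "r = [:c:]" by (rule degree_eq_zeroE)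
    with less.prems show False by simp
  qed
qed

text \<open>The pseudo-remainder of \<open>F\<close> by \<open>f\<close> vanishes at
  \<open>z\<close> and is 0 by minimality of the degree. The multiplier \<open>a\<close> is
  harmless, since \<open>f\<close> has a root and so cannot divide a nonzero constant.\<close>

lemma prime_elem_dvd_of_root:
  fixes f F :: "int poly" and z :: "'a::field_char_0"
  assumes f: "prime_elem f" "int_eval f z = 0" and F: "int_eval F z = 0"
  shows "f dvd F"
proof -
  have f0: "f \<noteq> 0" using f(1) by auto
  obtain a q where aq: "a \<noteq> 0" "smult a F = f * q + pseudo_mod F f"
    using pseudo_mod(1)[OF f0] by blast
  have "int_eval (pseudo_mod F f) z = 0"
    using arg_cong[OF aq(2), of "\<lambda>F. int_eval F z"] f F by simp
  hence "pseudo_mod F f = 0"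
    using prime_elem_root_degree_le[OF f, of "pseudo_mod F f"] pseudo_mod(2)[OF f0, of F] by linarith
  hence "f dvd [:a:] * F" using aq by simp
  hence "f dvd [:a:] \<or> f dvd F" using f(1) by (simp only: prime_elem_dvd_mult_iff)
  moreover have "\<not> f dvd [:a:]"
  proof
    assume "f dvd [:a:]"
    hence "degree f = 0" using aq(1) by (auto dest: dvd_imp_degree_le)
    then obtain c where "f = [:c:]" by (rule degree_eq_zeroE)
    with f f0 show False by simp
  qed
  ultimately show ?thesis by blast
qed

section \<open>Congruences modulo a prime for integral polynomials\<close>

lemma prime_dvd_binomial_expansion:
  fixes x y :: "'a::comm_ring_1"
  assumes "prime p"
  shows "of_nat p dvd (x + y) ^ p - x ^ p - y ^ p"
proof -
  have p: "p > 0" using assms by (rule prime_gt_0_nat)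
  have "{..p} = insert 0 (insert p {0<..<p})" using p by auto
  hence "(x + y) ^ p = y ^ p + (x ^ p + (\<Sum>k\<in>{0<..<p}. of_nat (p choose k) * x ^ k * y ^ (p - k)))"
    using p by (simp add: binomial_ring)
  hence "(x + y) ^ p - x ^ p - y ^ p = (\<Sum>k\<in>{0<..<p}. of_nat (p choose k) * x ^ k * y ^ (p - k))"
    by simp
  moreover have "of_nat p dvd (of_nat (p choose k) * x ^ k * y ^ (p - k) :: 'a)" if "k \<in> {0<..<p}" for k
  proof -
    have "p dvd k * (p choose k)"
      using that by (simp add: times_binomial_minus1_eq)
    moreover have "\<not> p dvd k" using that by (auto dest: dvd_imp_le)
    ultimately have "p dvd p choose k" using assms by (simp add: prime_dvd_mult_iff)
    then obtain c where "p choose k = p * c" by (rule dvdE)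
    thus ?thesis by (simp add: mult.assoc)
  qed
  ultimately show ?thesis by (auto intro: dvd_sum)
qed

text \<open>Fermat's little theorem, by induction with the binomial congruence; a general integer is
  replaced by its nonnegative residue.\<close>

lemma prime_dvd_power_diff:
  fixes a :: int
  assumes "prime p"
  shows "int p dvd a ^ p - a"
proof -
  have nonneg: "int p dvd int n ^ p - int n" for n
  proof (induction n)
    case 0
    show ?case by (simp add: zero_power[OF prime_gt_0_nat[OF assms]])
  next
    case (Suc n)
    have "int (Suc n) ^ p - int (Suc n) = ((int n + 1) ^ p - int n ^ p - 1 ^ p) + (int n ^ p - int n)"
      by (simp add: algebra_simps)
    thus ?case using Suc prime_dvd_binomial_expansion[OF assms, of "int n" 1] by (simp only: dvd_add of_nat_id)
  qed
  have "[a = int (nat (a mod p))] (mod int p)"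
    using prime_gt_0_nat[OF assms] by (simp add: cong_def)
  hence "[a ^ p - a = int (nat (a mod p)) ^ p - int (nat (a mod p))] (mod int p)"
    by (intro cong_diff cong_pow)
  with nonneg[of "nat (a mod p)"] show ?thesis by (simp add: cong_dvd_iff)
qed

text \<open>Modulo \<open>p\<close>, raising to the power \<open>p\<close> is additive and fixes the
  integral coefficients, so it only replaces \<open>X\<close> by \<open>X ^ p\<close>.\<close>

lemma prime_dvd_pcompose_diff_power:
  fixes f :: "int poly"
  assumes "prime p"
  shows "[:int p:] dvd pcompose f (monom 1 p) - f ^ p"
proof (induction f)
  case 0
  show ?case by (simp add: zero_power[OF prime_gt_0_nat[OF assms]])
next
  case (pCons a f)
  let ?X = "monom 1 1 :: int poly"
  have split: "pCons a f = ?X * f + [:a:]" by (simp add: monom_altdef)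
  have c: "[:a - a ^ p:] = [:a:] - [:a:] ^ p" by (simp add: poly_const_pow)
  have m: "(?X * f) ^ p = monom 1 p * f ^ p" by (simp add: power_mult_distrib monom_power)
  have "pcompose (pCons a f) (monom 1 p) - pCons a f ^ p
      = [:a - a ^ p:] + monom 1 p * (pcompose f (monom 1 p) - f ^ p)
        - (pCons a f ^ p - (?X * f) ^ p - [:a:] ^ p)"
    unfolding pcompose_pCons c m right_diff_distrib by simp
  moreover have "[:int p:] dvd [:a - a ^ p:]"
  proof -
    obtain c where "a ^ p - a = int p * c" using prime_dvd_power_diff[OF assms, of a] by (rule dvdE)
    hence "[:a - a ^ p:] = [:int p:] * [:- c:]" by (simp add: algebra_simps)
    thus ?thesis by (rule dvdI)
  qed
  moreover have "[:int p:] dvd pCons a f ^ p - (?X * f) ^ p - [:a:] ^ p"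
    unfolding split using prime_dvd_binomial_expansion[OF assms, of "?X * f" "[:a:]"] by (simp add: of_nat_poly)
  ultimately show ?case using pCons by (metis dvd_add dvd_diff dvd_mult)
qed

text \<open>The leading coefficient of \<open>f\<close> is a unit, so \<open>f\<close> keeps its
  positive degree modulo \<open>p\<close>, and no multiple of it is a nonzero constant
  there.\<close>

lemma not_prime_dvd_mult_monic_const:
  fixes f v w :: "int poly"
  assumes p: "prime p" "\<not> int p dvd n" and f: "coeff f (degree f) dvd 1" "degree f > 0"
  shows "f * v + smult (int p) w \<noteq> [:n:]"
proof
  assume eq: "f * v + smult (int p) w = [:n:]"
  \<comment> \<open>With the coefficients of \<open>v\<close> reduced to residues, the leading
    coefficient of a nonzero \<open>v1\<close> is not divisible by \<open>p\<close>.\<close>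
  define v1 where "v1 = map_poly (\<lambda>c. c mod int p) v"
  define v2 where "v2 = map_poly (\<lambda>c. c div int p) v"
  have v: "v = v1 + smult (int p) v2"
    by (rule poly_eqI) (simp add: v1_def v2_def coeff_map_poly)
  have fv1: "f * v1 = [:n:] - smult (int p) (w + f * v2)"
    using eq unfolding v by (simp add: algebra_simps smult_add_right)
  show False
  proof (cases "v1 = 0")
    case True
    hence "n = int p * coeff (w + f * v2) 0"
      using arg_cong[OF fv1, of "\<lambda>F. coeff F 0"] by simp
    thus False using p(2) by simp
  next
    case False
    let ?d = "degree f + degree v1"
    have "coeff (f * v1) ?d = coeff f (degree f) * coeff v1 (degree v1)"
      by (rule coeff_mult_degree_sum)
    moreover have "coeff (f * v1) ?d = - (int p * coeff (w + f * v2) ?d)"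
      unfolding fv1 using f(2) by (simp add: coeff_pCons split: nat.split)
    ultimately have "int p dvd coeff f (degree f) * coeff v1 (degree v1)"
      by (metis dvd_minus_iff dvd_triv_left)
    hence "int p dvd coeff v1 (degree v1)"
      using f(1) by (metis dvd_mult_unit_iff mult.commute)
    hence "coeff v1 (degree v1) = 0"
      by (simp add: v1_def coeff_map_poly mod_0_imp_dvd dvd_mod_iff dvd_imp_mod_0)
    thus False using False by simp
  qed
qed

text \<open>If \<open>z ^ p\<close> is not a root of \<open>f\<close>, then differentiating \<open>X ^ n - 1 = f * h\<close> shows that
  \<open>f (z ^ p)\<close> divides \<open>n\<close>, whereas \<open>f (z ^ p)\<close> is congruent to \<open>f z ^ p = 0\<close> modulo \<open>p\<close>.\<close>

lemma int_eval_prime_power_root: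
  fixes f :: "int poly" and z :: "'a::field_char_0"
  assumes f: "prime_elem f" "f dvd monom 1 n - 1" "int_eval f z = 0" and p: "prime p" "\<not> p dvd n"
  shows "int_eval f (z ^ p) = 0"
proof (rule ccontr)
  assume nz: "int_eval f (z ^ p) \<noteq> 0"
  have n: "n > 0" using p(2) by (cases n) auto
  obtain h where h: "monom 1 n - 1 = f * h" using f(2) by (rule dvdE)
  have P0: "monom 1 n - 1 \<noteq> (0 :: int poly)" using n by (simp add: monom_eq_1_iff)
  have "z ^ n = 1"
    using arg_cong[OF h, of "\<lambda>F. int_eval F z"] f(3) by simp
  hence zpn: "(z ^ p) ^ n = 1" by (metis power_mult mult.commute power_one)
  hence hz: "int_eval h (z ^ p) = 0"
    using arg_cong[OF h, of "\<lambda>F. int_eval F (z ^ p)"] nz by simp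
  \<comment> \<open>Multiplying the derivative by \<open>X\<close> restores the exponent
    \<open>n\<close>, so the left side takes the value \<open>n\<close> at
    \<open>z ^ p\<close>.\<close>
  have "monom (int n) n = monom 1 1 * pderiv (monom 1 n - 1)"
    using n by (simp add: pderiv_diff pderiv_monom mult_monom)
  also have "\<dots> = monom 1 1 * (f * pderiv h + h * pderiv f)"
    by (simp add: h pderiv_mult)
  finally have deriv_eq: "monom (int n) n = monom 1 1 * (f * pderiv h + h * pderiv f)" .
  have deriv: "of_nat n = z ^ p * (int_eval f (z ^ p) * int_eval (pderiv h) (z ^ p))"
    using arg_cong[OF deriv_eq, of "\<lambda>F. int_eval F (z ^ p)"] hz zpn by simp
  obtain u where u: "pcompose f (monom 1 p) - f ^ p = [:int p:] * u"
    using prime_dvd_pcompose_diff_power[OF p(1)] by (rule dvdE)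
  have fz: "int_eval f (z ^ p) = of_nat p * int_eval u z"
    using arg_cong[OF u, of "\<lambda>F. int_eval F z"] f(3)
    by (simp add: zero_power[OF prime_gt_0_nat[OF p(1)]])
  \<comment> \<open>Chosen so that \<open>n - p * w\<close> is an integral polynomial vanishing at
    \<open>z\<close>; it is then a multiple of \<open>f\<close>, although \<open>p\<close> does not
    divide \<open>n\<close>.\<close>
  define w where "w = monom 1 p * (u * pcompose (pderiv h) (monom 1 p))"
  have "int_eval ([:int n:] - smult (int p) w) z = 0"
    using deriv unfolding fz w_def by (simp add: algebra_simps)
  hence "f dvd [:int n:] - smult (int p) w"
    by (rule prime_elem_dvd_of_root[OF f(1,3)])
  then obtain v where "[:int n:] - smult (int p) w = f * v" by (rule dvdE)
  hence eq: "f * v + smult (int p) w = [:int n:]" by (simp add: algebra_simps)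
  \<comment> \<open>The leading coefficients of \<open>f\<close> and \<open>h\<close> multiply to
    that of \<open>X ^ n - 1\<close>, which is 1.\<close>
  have "coeff f (degree f) * coeff h (degree h) = coeff (f * h) (degree f + degree h)"
    by (rule coeff_mult_degree_sum[symmetric])
  also have "degree f + degree h = degree (f * h)"
    using P0 unfolding h by (subst degree_mult_eq) auto
  also have "f * h = monom 1 n - 1" by (rule h[symmetric])
  also have "degree (monom 1 n - 1 :: int poly) = n"
    using n degree_add_eq_left[of "- 1" "monom 1 n :: int poly"] by (simp add: degree_monom_eq)
  also have "coeff (monom 1 n - 1 :: int poly) n = 1" using n by simp
  finally have "coeff f (degree f) dvd 1" by (metis dvd_triv_left)
  moreover have "degree f > 0"
  proof (rule ccontr)
    assume "\<not> degree f > 0"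
    then obtain c where "f = [:c:]" using degree_eq_zeroE by blast
    with f show False by auto
  qed
  ultimately show False
    using not_prime_dvd_mult_monic_const[of p "int n" f v w] p eq by simp
qed

text \<open>Irreducibility of the cyclotomic polynomials, phrased without minimal polynomials.\<close>

theorem int_eval_coprime_power_root:
  fixes F :: "int poly" and z :: "'a::field_char_0"
  assumes "n > 0" "z ^ n = 1" "coprime b n" "b > 0" and F: "int_eval F z = 0"
  shows "int_eval F (z ^ b) = 0"
proof -
  let ?P = "monom 1 n - 1 :: int poly"
  have P0: "?P \<noteq> 0"
    using assms(1) by (auto simp: monom_eq_1_iff)
  \<comment> \<open>The prime factors recover \<open>?P\<close> only up to a unit; divisibility is
    enough for one of them to vanish at \<open>z\<close>.\<close>
  have "?P dvd prod_mset (prime_factorization ?P)"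
    using prod_mset_prime_factorization_weak[OF P0] by (metis dvd_refl dvd_normalize_iff normalize_dvd_iff)
  then obtain g where "prod_mset (prime_factorization ?P) = ?P * g" by (rule dvdE)
  hence "int_eval (prod_mset (prime_factorization ?P)) z = 0"
    using assms(2) by simp
  then obtain f where f: "f \<in># prime_factorization ?P" "int_eval f z = 0"
    by (auto simp: prod_mset_zero_iff)
  hence pf: "prime_elem f" and dvd: "f dvd ?P"
    by (auto simp: in_prime_factors_iff)
  \<comment> \<open>Induction strips one prime \<open>p\<close> from \<open>m = l * p\<close> and
    applies the prime case to the root \<open>z ^ l\<close>.\<close>
  have "coprime m n \<Longrightarrow> m > 0 \<Longrightarrow> int_eval f (z ^ m) = 0" for m
  proof (induction m rule: less_induct)
    case (less m)
    show ?case
    proof (cases "m = 1")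
      case True
      with f show ?thesis by simp
    next
      case False
      then obtain p where p: "prime p" "p dvd m" using prime_factor_nat by blast
      then obtain l where l: "m = l * p" by (metis dvd_def mult.commute)
      with less.prems prime_gt_1_nat[OF p(1)] have "l < m" "coprime l n" "l > 0" by auto
      hence "int_eval f (z ^ l) = 0" by (rule less.IH)
      moreover have "\<not> p dvd n" using p less.prems(1) by (meson coprime_common_divisor not_prime_unit)
      ultimately show ?thesis
        using int_eval_prime_power_root[OF pf dvd, of "z ^ l" p] p(1) by (simp add: l power_mult)
    qed
  qed
  hence "int_eval f (z ^ b) = 0" using assms by blast
  moreover have "f dvd F" by (rule prime_elem_dvd_of_root[OF pf f(2) F])
  ultimately show ?thesis by (auto elim: dvdE)
qed

section \<open>Derivatives of the cotangent\<close>

lemma one_minus_in_Ints_iff: "1 - z \<in> \<int> \<longleftrightarrow> (z :: complex) \<in> \<int>"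
  by (metis Ints_1 Ints_diff diff_diff_eq2 diff_add_cancel add_diff_cancel_left')

lemma not_nonpos_Ints: "z \<notin> \<int> \<Longrightarrow> z \<notin> \<int>\<^sub>\<le>\<^sub>0"
  using nonpos_Ints_subset_Ints by blast

lemma exp_two_pi_ii_eq_1_iff: "exp (2 * of_real pi * \<i> * z) = 1 \<longleftrightarrow> z \<in> \<int>"
proof -
  have "exp (2 * of_real pi * \<i> * z) = 1 \<longleftrightarrow> Im z = 0 \<and> (\<exists>n::int. Re z = of_int n)"
    by (simp add: exp_eq_1)
  also have "\<dots> \<longleftrightarrow> z \<in> \<int>"
  proof
    assume "Im z = 0 \<and> (\<exists>n::int. Re z = of_int n)"
    then obtain n :: int where "z = of_int n" by (auto simp: complex_eq_iff)
    thus "z \<in> \<int>" by simp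
  qed (auto elim!: Ints_cases)
  finally show ?thesis .
qed

text \<open>Off the integers, \<open>Gamma z * Gamma (1 - z) * sin (pi * z)\<close> is the constant
  \<open>pi\<close>. Its derivative is therefore 0, and dividing by the Gamma factors gives the
  formula.\<close>

lemma Digamma_reflection:
  fixes z :: complex
  assumes z: "z \<notin> \<int>"
  shows "Digamma (1 - z) - Digamma z = of_real pi * cot (of_real pi * z)"
proof -
  let ?F = "\<lambda>z::complex. Gamma z * Gamma (1 - z) * sin (of_real pi * z)"
  have sin_nz: "sin (of_real pi * u) \<noteq> 0" if "u \<notin> \<int>" for u :: complex
    using that by (auto simp: sin_eq_0 mult.commute)
  have z': "1 - z \<notin> \<int>\<^sub>\<le>\<^sub>0" "z \<notin> \<int>\<^sub>\<le>\<^sub>0"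
    using z one_minus_in_Ints_iff by (auto intro!: not_nonpos_Ints)
  let ?G = "Gamma z * Gamma (1 - z)" and ?s = "sin (of_real pi * z)" and ?c = "cos (of_real pi * z)"
  have "(?F has_field_derivative
      ?G * (Digamma z - Digamma (1 - z)) * ?s + ?G * (of_real pi * ?c)) (at z)"
    using z' by (auto intro!: derivative_eq_intros simp: algebra_simps)
  moreover have "((\<lambda>_. of_real pi) has_field_derivative 0) (at z)" by simp
  hence "(?F has_field_derivative 0) (at z)"
    by (rule has_field_derivative_transform_within_open[of _ _ _ "- \<int>"])
       (use z sin_nz in \<open>auto simp: Gamma_reflection_complex open_Compl\<close>)
  ultimately have "?G * (Digamma z - Digamma (1 - z)) * ?s + ?G * (of_real pi * ?c) = 0"
    by (rule DERIV_unique)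
  hence "?G * ((Digamma z - Digamma (1 - z)) * ?s + of_real pi * ?c) = 0"
    by (simp add: algebra_simps)
  moreover have "?G \<noteq> 0" using z' by (simp add: Gamma_eq_zero_iff)
  ultimately have "(Digamma z - Digamma (1 - z)) * ?s + of_real pi * ?c = 0" by simp
  hence "(Digamma (1 - z) - Digamma z) * ?s = of_real pi * ?c" by (simp add: algebra_simps)
  thus ?thesis using sin_nz[OF z] by (simp add: cot_def nonzero_eq_divide_eq)
qed

lemma cot_exp:
  fixes z :: complex
  defines "w \<equiv> exp (2 * of_real pi * \<i> * z)"
  shows "cot (of_real pi * z) = \<i> * (w + 1) / (w - 1)"
proof -
  define e where "e = exp (\<i> * (of_real pi * z))"
  have e: "e \<noteq> 0" "w = e\<^sup>2" "exp (- (\<i> * (of_real pi * z))) = inverse e"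
    by (auto simp: e_def w_def exp_minus exp_double[symmetric] mult_ac)
  have "cot (of_real pi * z) = ((e + inverse e) / 2) / ((e - inverse e) / (2 * \<i>))"
    unfolding cot_def sin_exp_eq cos_exp_eq e(3) e_def[symmetric] ..
  also have "\<dots> = \<i> * (e * (e + inverse e)) / (e * (e - inverse e))"
  proof -
    \<comment> \<open>The case \<open>d = 0\<close> is a pole of the cotangent, where both sides are
      0 by division by zero.\<close>
    have "s / 2 / (d / (2 * \<i>)) = \<i> * (e * s) / (e * d)" for s d
      using e(1) by (cases "d = 0") (simp_all add: field_simps)
    thus ?thesis .
  qed
  also have "e * (e + inverse e) = w + 1"
    using e by (simp add: power2_eq_square ring_distribs)
  also have "e * (e - inverse e) = w - 1"
    using e by (simp add: power2_eq_square ring_distribs)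
  finally show ?thesis .
qed

text \<open>With \<open>w = exp (2 * pi * \<i> * z)\<close>, the function \<open>cot (pi * z)\<close> is \<open>\<i> * (w + 1) / (w - 1)\<close>, and
  differentiating in \<open>z\<close> acts as \<open>2 * pi * \<i> * w * d/dw\<close>.\<close>

fun cot_poly :: "nat \<Rightarrow> int poly" where
  "cot_poly 0 = [:1, 1:]"
| "cot_poly (Suc m) = [:0, 1:] * ([:- 1, 1:] * pderiv (cot_poly m) - smult (int (Suc m)) (cot_poly m))"

lemma has_field_derivative_int_eval:
  "(int_eval F has_field_derivative int_eval (pderiv F) w) (at (w :: complex))"
proof (induction F)
  case 0
  show ?case by (simp add: int_eval_def)
next
  case (pCons a F)
  have "((\<lambda>w. of_int a + w * int_eval F w) has_field_derivative int_eval F w + w * int_eval (pderiv F) w) (at w)"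
    by (auto intro!: derivative_eq_intros pCons.IH)
  thus ?case by (simp add: pderiv_pCons)
qed

text \<open>The reflection formula for \<open>Digamma\<close> is differentiated \<open>m\<close>
  times: each step contributes a sign for the argument \<open>1 - z\<close> and a factor
  \<open>2 * pi * i\<close>, and \<open>cot_poly\<close> follows the numerators of the quotient
  rule.\<close>

lemma Polygamma_reflection:
  fixes z :: complex
  assumes "z \<notin> \<int>"
  defines "w \<equiv> exp (2 * of_real pi * \<i> * z)"
  shows "(- 1) ^ m * Polygamma m (1 - z) - Polygamma m z =
    (of_real pi * \<i>) * (2 * of_real pi * \<i>) ^ m * (int_eval (cot_poly m) w / (w - 1) ^ Suc m)"
  using assms(1) unfolding w_def
proof (induction m arbitrary: z)
  case 0
  thus ?case by (simp add: Digamma_reflection cot_exp add.commute)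
next
  case (Suc m)
  let ?L = "\<lambda>z. (- 1) ^ m * Polygamma m (1 - z) - Polygamma m z :: complex"
  let ?e = "\<lambda>z. exp (2 * of_real pi * \<i> * z)"
  let ?c = "(of_real pi * \<i>) * (2 * of_real pi * \<i>) ^ m"
  let ?R = "\<lambda>z. ?c * (int_eval (cot_poly m) (?e z) / (?e z - 1) ^ Suc m)"
  have z': "1 - z \<notin> \<int>\<^sub>\<le>\<^sub>0" "z \<notin> \<int>\<^sub>\<le>\<^sub>0"
    using Suc.prems one_minus_in_Ints_iff by (auto intro!: not_nonpos_Ints)
  have nz: "?e z - 1 \<noteq> 0" using Suc.prems exp_two_pi_ii_eq_1_iff[of z] by simp
  have L: "(?L has_field_derivative (- 1) ^ Suc m * Polygamma (Suc m) (1 - z) - Polygamma (Suc m) z) (at z)"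
    using z' by (auto intro!: derivative_eq_intros)
  have e: "(?e has_field_derivative 2 * of_real pi * \<i> * ?e z) (at z)"
    by (auto intro!: derivative_eq_intros)
  have num: "((\<lambda>z. int_eval (cot_poly m) (?e z)) has_field_derivative
      int_eval (pderiv (cot_poly m)) (?e z) * (2 * of_real pi * \<i> * ?e z)) (at z)"
    by (rule DERIV_chain2[OF has_field_derivative_int_eval e])
  have den: "((\<lambda>z. (?e z - 1) ^ Suc m) has_field_derivative
      of_nat (Suc m) * (?e z - 1) ^ m * (2 * of_real pi * \<i> * ?e z)) (at z)"
    using DERIV_power_Suc[OF DERIV_diff[OF e DERIV_const[of 1]], of m] by (simp add: mult_ac)
  have alg: "(p' * (y * u) * v ^ Suc m - p * (of_nat (Suc m) * v ^ m * (y * u))) / (v ^ Suc m * v ^ Suc m)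
      = y * (u * (v * p' - of_nat (Suc m) * p)) / v ^ Suc (Suc m)" if "v \<noteq> 0" for p p' u v y :: complex
  proof -
    have "p' * (y * u) * v ^ Suc m - p * (of_nat (Suc m) * v ^ m * (y * u)) =
        (y * (u * (v * p' - of_nat (Suc m) * p))) * v ^ m"
      by (simp add: algebra_simps del: of_nat_Suc)
    moreover have "v ^ Suc m * v ^ Suc m = v ^ Suc (Suc m) * v ^ m" by simp
    ultimately show ?thesis by (simp only: mult_divide_mult_cancel_right[OF power_not_zero[OF that]])
  qed
  have "(?R has_field_derivative ?c * ((2 * of_real pi * \<i>) * int_eval (cot_poly (Suc m)) (?e z) / (?e z - 1) ^ Suc (Suc m))) (at z)"
  proof (rule DERIV_cmult)
    have "int_eval (cot_poly (Suc m)) (?e z) =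
        ?e z * ((?e z - 1) * int_eval (pderiv (cot_poly m)) (?e z) - of_nat (Suc m) * int_eval (cot_poly m) (?e z))"
      by (simp add: left_diff_distrib del: of_nat_Suc)
    with DERIV_divide[OF num den] nz show "((\<lambda>z. int_eval (cot_poly m) (?e z) / (?e z - 1) ^ Suc m) has_field_derivative
        (2 * of_real pi * \<i>) * int_eval (cot_poly (Suc m)) (?e z) / (?e z - 1) ^ Suc (Suc m)) (at z)"
      by (simp only: alg power_not_zero not_False_eq_True)
  qed
  \<comment> \<open>By the induction hypothesis \<open>?L\<close> and \<open>?R\<close> agree on the
    open complement of the integers, so they have the same derivative there.\<close>
  hence "(?L has_field_derivative ?c * ((2 * of_real pi * \<i>) * int_eval (cot_poly (Suc m)) (?e z) / (?e z - 1) ^ Suc (Suc m))) (at z)"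
    by (rule has_field_derivative_transform_within_open[of _ _ _ "- \<int>"])
       (use Suc in \<open>auto simp: open_Compl\<close>)
  from DERIV_unique[OF L this] show ?case
    by (simp only: power_Suc mult_ac times_divide_eq_right)
qed

section \<open>Hurwitz zeta values as polygamma values\<close>

lemma hurwitz_zeta_of_nat:
  assumes "k > 1" "x > 0"
  shows "(\<lambda>n. inverse ((of_real x + of_nat n) ^ k)) sums hurwitz_zeta (of_nat k) x"
proof -
  have "summable (\<lambda>n. inverse ((complex_of_real x + of_nat n) ^ k))"
    using assms by (intro Polygamma_converges') auto
  moreover have "complex_of_real (real n + x) powr (- of_nat k) = inverse ((of_real x + of_nat n) ^ k)" for n
    using assms by (simp add: powr_minus powr_nat' add.commute)
  ultimately show ?thesis
    unfolding hurwitz_zeta_def by (simp add: summable_sums)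
qed

lemma hurwitz_zeta_eq_Polygamma:
  assumes "x > 0" "m > 0"
  shows "hurwitz_zeta (of_nat (Suc m)) x = (- 1) ^ Suc m * Polygamma m (of_real x) / fact m"
  using sums_unique2[OF hurwitz_zeta_of_nat[of "Suc m" x] Polygamma_LIMSEQ[of "complex_of_real x" m]] assms
  by simp

text \<open>The sign \<open>(- 1) ^ Suc m\<close> of the combination is the one that turns it into
  the left side of the polygamma reflection formula, up to the factor
  \<open>(- 1) ^ m / m!\<close>.\<close>

lemma hurwitz_zeta_reflection:
  assumes "m > 0" "0 < x" "x < 1"
  defines "w \<equiv> exp (2 * of_real pi * \<i> * of_real x)"
  shows "hurwitz_zeta (of_nat (Suc m)) x + (- 1) ^ Suc m * hurwitz_zeta (of_nat (Suc m)) (1 - x) =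
    (- 1) ^ m / fact m * ((of_real pi * \<i>) * (2 * of_real pi * \<i>) ^ m) * (int_eval (cot_poly m) w / (w - 1) ^ Suc m)"
proof -
  have "complex_of_real x \<notin> \<int>"
    using assms(2,3) by (auto elim!: Ints_cases simp: complex_eq_iff)
  note * = Polygamma_reflection[OF this, of m]
  have sq: "(- 1) ^ m * ((- 1) ^ m * y) = (y :: complex)" for y
    by (simp add: mult.assoc[symmetric] power_mult_distrib[symmetric])
  have "hurwitz_zeta (of_nat (Suc m)) x + (- 1) ^ Suc m * hurwitz_zeta (of_nat (Suc m)) (1 - x)
     = (- 1) ^ m / fact m * ((- 1) ^ m * Polygamma m (1 - of_real x) - Polygamma m (of_real x))"
    using assms(1-3) by (simp add: hurwitz_zeta_eq_Polygamma right_diff_distrib diff_divide_distrib sq del: of_nat_Suc)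
  thus ?thesis unfolding * w_def by (simp add: mult.assoc)
qed

section \<open>Algebraic numbers and imaginary quadratic fields\<close>

lemma field_complex_ring: "field complex_ring"
  by (rule field_from_type_algebra)

interpretation complex_ring: ring complex_ring
  by (rule ring_from_type_algebra)

lemma complex_ring_simps [simp]:
  "carrier complex_ring = UNIV"
  "x \<otimes>\<^bsub>complex_ring\<^esub> y = x * y"
  "x \<oplus>\<^bsub>complex_ring\<^esub> y = x + y"
  "\<one>\<^bsub>complex_ring\<^esub> = 1"
  "\<zero>\<^bsub>complex_ring\<^esub> = 0"
  by (simp_all add: ring_of_type_algebra_def)

lemma complex_ring_a_inv: "\<ominus>\<^bsub>complex_ring\<^esub> x = - x"
  by (rule complex_ring.minus_equality) auto

lemma complex_ring_m_inv: "x \<noteq> 0 \<Longrightarrow> inv\<^bsub>complex_ring\<^esub> x = inverse x"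
  by (rule complex_ring.inv_char) auto

lemma complex_ring_nat_pow: "x [^]\<^bsub>complex_ring\<^esub> (n :: nat) = x ^ n"
  by (induction n) (simp_all add: complex_ring.nat_pow_Suc mult.commute)

lemma subfield_complex_ringI:
  assumes "1 \<in> S" "\<And>x. x \<in> S \<Longrightarrow> - x \<in> S" "\<And>x y. x \<in> S \<Longrightarrow> y \<in> S \<Longrightarrow> x + y \<in> S"
    "\<And>x y. x \<in> S \<Longrightarrow> y \<in> S \<Longrightarrow> x * y \<in> S" "\<And>x. x \<in> S \<Longrightarrow> x \<noteq> 0 \<Longrightarrow> inverse x \<in> S"
  shows "subfield S complex_ring"
  using assms by (intro field.subfieldI'[OF field_complex_ring] complex_ring.subringI)
    (auto simp: complex_ring_a_inv complex_ring_m_inv)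

lemma subfield_Rats: "subfield \<rat> complex_ring"
  by (rule subfield_complex_ringI) auto

text \<open>Polynomials of HOL-Algebra list the leading coefficient first, whence the
  reversal.\<close>

lemma complex_ring_eval: "complex_ring.eval p x = poly (Poly (rev p)) x"
  by (induction p) (simp_all add: Poly_snoc poly_monom complex_ring_nat_pow add.commute)

text \<open>Identifying the two notions of algebraic number transfers closure under sums and
  products from the field of algebraic elements.\<close>

lemma algebraic_over_Rats_iff: "(complex_ring.algebraic over \<rat>) x \<longleftrightarrow> algebraic x"
proof
  assume "(complex_ring.algebraic over \<rat>) x"
  then obtain p where p: "p \<in> carrier (\<rat>[X]\<^bsub>complex_ring\<^esub>)" "p \<noteq> []" "complex_ring.eval p x = 0"
    using domain.algebraicE[OF field.axioms(1)[OF field_complex_ring] subfieldE(1)[OF subfield_Rats]] by auto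
  from p(1,2) have set: "set p \<subseteq> \<rat>" and hd: "hd p \<noteq> 0"
    by (auto simp: univ_poly_carrier[symmetric] polynomial_def)
  show "algebraic x"
  proof (rule algebraicI')
    show "poly (Poly (rev p)) x = 0" using p(3) by (simp add: complex_ring_eval)
    show "coeff (Poly (rev p)) i \<in> \<rat>" for i
      using set nth_mem[of i "rev p"] by (auto simp: nth_default_def)
    have "coeff (Poly (rev p)) (length p - 1) = hd p"
      using p(2) by (simp add: nth_default_def rev_nth hd_conv_nth)
    thus "Poly (rev p) \<noteq> 0" using hd by (metis coeff_0)
  qed
next
  assume "algebraic x"
  then obtain P where P: "\<And>i. coeff P i \<in> \<rat>" "P \<noteq> 0" "poly P x = 0"
    by (auto simp: algebraic_altdef)
  show "(complex_ring.algebraic over \<rat>) x"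
  proof (rule complex_ring.algebraicI[of "rev (coeffs P)"])
    show "rev (coeffs P) \<in> carrier (\<rat>[X]\<^bsub>complex_ring\<^esub>)"
      using P(1,2) by (auto simp: univ_poly_carrier[symmetric] polynomial_def
          hd_rev last_coeffs_eq_coeff_degree coeffs_def)
  qed (use P in \<open>auto simp: complex_ring_eval\<close>)
qed

lemma subfield_algebraic: "subfield {x. algebraic x} complex_ring"
  using field.subfield_of_algebraics[OF field_complex_ring subfield_Rats] by (simp add: algebraic_over_Rats_iff)

lemma algebraic_complex_add: "algebraic x \<Longrightarrow> algebraic y \<Longrightarrow> algebraic (x + y)"
  and algebraic_complex_mult: "algebraic x \<Longrightarrow> algebraic y \<Longrightarrow> algebraic (x * y)"
  for x y :: complex
  using subringE(6,7)[OF subfieldE(1)[OF subfield_algebraic], of x y]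
  by simp_all

lemma algebraic_complex_divide: "algebraic x \<Longrightarrow> algebraic y \<Longrightarrow> algebraic (x / y)" for x y :: complex
  unfolding divide_inverse by (intro algebraic_complex_mult algebraic_inverse)

lemma algebraic_complex_power: "algebraic x \<Longrightarrow> algebraic (x ^ n)" for x :: complex
  by (induction n) (auto intro: algebraic_complex_mult)

lemma algebraic_complex_sum: "(\<And>i. i \<in> A \<Longrightarrow> algebraic (f i)) \<Longrightarrow> algebraic (\<Sum>i\<in>A. f i)"
  for f :: "'a \<Rightarrow> complex"
  by (induction A rule: infinite_finite_induct) (auto intro: algebraic_complex_add)

lemma algebraic_int_eval: "algebraic z \<Longrightarrow> algebraic (int_eval F z)" for z :: complex
  by (induction F) (auto intro: algebraic_complex_add algebraic_complex_mult)

lemma not_algebraic_ii_pi_power: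
  assumes "n > 0"
  shows "\<not> algebraic ((\<i> * of_real pi) ^ n)"
proof
  assume "algebraic ((\<i> * of_real pi) ^ n)"
  hence "algebraic (\<i> * of_real pi)"
    by (rule algebraic_root[where p = "monom 1 n"]) (use assms in \<open>auto simp: poly_monom degree_monom_eq\<close>)
  thus False using not_algebraic_ii_pi by simp
qed

section \<open>Linear independence over an imaginary quadratic field\<close>

lemma rat_adjoin_ii_sqrt:
  assumes "d \<ge> 1" and "x \<in> rat_adjoin (\<i> * complex_of_real (sqrt (real d)))"
  shows "Re x \<in> \<rat>" "Im x / sqrt (real d) \<in> \<rat>"
proof -
  let ?S = "{x. Re x \<in> \<rat> \<and> Im x / sqrt (real d) \<in> \<rat>}"
  have sq: "sqrt (real d) * sqrt (real d) = real d" "sqrt (real d) \<noteq> 0" using assms(1) by auto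
  have prod: "Im x * Im y = (Im x / sqrt (real d)) * (Im y / sqrt (real d)) * real d" for x y
  proof -
    have "a * b = (a / s) * (b / s) * (s * s)" if "s \<noteq> 0" for a b s :: real
      using that by simp
    from this[OF sq(2)] show ?thesis by (simp only: sq(1))
  qed
  \<comment> \<open>\<open>?S\<close> consists of the numbers \<open>a + b * i * sqrt d\<close> with
    rational \<open>a\<close> and \<open>b\<close>. It is a field containing the generator, so it
    contains the generated field.\<close>
  have "subfield ?S complex_ring"
  proof (rule subfield_complex_ringI)
    fix x y assume xy: "x \<in> ?S" "y \<in> ?S"
    have "Im x * Im y \<in> \<rat>" unfolding prod using xy by (intro Rats_mult Rats_of_nat) simp_all
    hence "Re (x * y) \<in> \<rat>" using xy by simp
    moreover have "Re x * (Im y / sqrt (real d)) + (Im x / sqrt (real d)) * Re y \<in> \<rat>"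
      using xy by (intro Rats_add Rats_mult) simp_all
    hence "Im (x * y) / sqrt (real d) \<in> \<rat>"
      by (simp add: add_divide_distrib)
    ultimately show "x * y \<in> ?S" by blast
  next
    fix x assume x: "x \<in> ?S"
    have sum: "(Re x)\<^sup>2 + (Im x)\<^sup>2 \<in> \<rat>"
      unfolding power2_eq_square prod using x by (intro Rats_add Rats_mult Rats_of_nat) simp_all
    hence "Re (inverse x) \<in> \<rat>" using x by simp
    moreover have "- (Im x / sqrt (real d)) / ((Re x)\<^sup>2 + (Im x)\<^sup>2) \<in> \<rat>"
      using x by (intro Rats_divide[OF _ sum]) simp
    hence "Im (inverse x) / sqrt (real d) \<in> \<rat>"
      by (simp add: mult.commute)
    ultimately show "inverse x \<in> ?S" by blast
  qed (auto simp: add_divide_distrib)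
  moreover have "\<i> * complex_of_real (sqrt (real d)) \<in> ?S" using sq by simp
  ultimately have "rat_adjoin (\<i> * complex_of_real (sqrt (real d))) \<subseteq> ?S"
    unfolding rat_adjoin_def by (intro field.generate_field_min_subfield1[OF field_complex_ring]) auto
  with assms(2) show "Re x \<in> \<rat>" "Im x / sqrt (real d) \<in> \<rat>" by auto
qed

lemma combine_Re_Im:
  assumes "set Us \<subseteq> \<real>"
  shows "complex_ring.combine (map (\<lambda>k. of_real (Re k)) Ks) Us = of_real (Re (complex_ring.combine Ks Us))"
    "complex_ring.combine (map (\<lambda>k. of_real (Im k / c)) Ks) Us = of_real (Im (complex_ring.combine Ks Us) / c)"
proof -
  have "complex_ring.combine (map (\<lambda>k. of_real (Re k)) Ks) Us = of_real (Re (complex_ring.combine Ks Us)) \<and>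
    complex_ring.combine (map (\<lambda>k. of_real (Im k / c)) Ks) Us = of_real (Im (complex_ring.combine Ks Us) / c)"
    using assms
  proof (induction Ks Us rule: complex_ring.combine.induct)
    case (1 k Ks u Us)
    then obtain r where "u = of_real r" by (auto elim: Reals_cases)
    with 1 show ?case by (auto simp: add_divide_distrib)
  qed auto
  thus "complex_ring.combine (map (\<lambda>k. of_real (Re k)) Ks) Us = of_real (Re (complex_ring.combine Ks Us))"
    "complex_ring.combine (map (\<lambda>k. of_real (Im k / c)) Ks) Us = of_real (Im (complex_ring.combine Ks Us) / c)"
    by auto
qed

text \<open>For real vectors, the real part of a relation and its imaginary part divided by
  \<open>sqrt d\<close> are both relations with rational coefficients.\<close>

lemma independent_imaginary_quadratic:
  fixes Us :: "complex list"
  assumes d: "d \<ge> 1" and K: "K = rat_adjoin (\<i> * complex_of_real (sqrt (real d)))"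
    and real: "set Us \<subseteq> \<real>"
    and indep: "\<And>rs. length rs = length Us \<Longrightarrow> set rs \<subseteq> \<rat> \<Longrightarrow> complex_ring.combine rs Us = 0 \<Longrightarrow> set rs \<subseteq> {0}"
  shows "complex_ring.independent K Us"
proof (rule ccontr)
  assume dep: "\<not> complex_ring.independent K Us"
  have subfield: "subfield K complex_ring" unfolding K by (rule subfield_rat_adjoin)
  obtain Ks where Ks: "length Ks = length Us" "complex_ring.combine Ks Us = 0" "set Ks \<subseteq> K" "set Ks \<noteq> {0}"
    using complex_ring.dependent_imp_non_trivial_combine[OF subfield _ dep] by auto
  \<comment> \<open>The condition \<open>set Ks \<noteq> {0}\<close> also holds for an empty list,
    so it expresses nontriviality only when \<open>Us\<close> is nonempty.\<close>
  have "Us \<noteq> []" using dep by auto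
  have rat: "Re k \<in> \<rat>" "Im k / sqrt (real d) \<in> \<rat>" if "k \<in> set Ks" for k
    using rat_adjoin_ii_sqrt[OF d, of k] that Ks(3) K by auto
  have "set (map (\<lambda>k. complex_of_real (Re k)) Ks) \<subseteq> {0}"
    using Ks rat combine_Re_Im(1)[OF real] by (intro indep) (auto elim!: Rats_cases)
  moreover have "set (map (\<lambda>k. complex_of_real (Im k / sqrt (real d))) Ks) \<subseteq> {0}"
    using Ks rat combine_Re_Im(2)[OF real] by (intro indep) (auto elim!: Rats_cases simp del: of_real_divide)
  ultimately have "set Ks \<subseteq> {0}"
    using d by (auto simp: complex_eq_iff image_subset_iff)
  moreover have "set Ks \<noteq> {}" using Ks(1) \<open>Us \<noteq> []\<close> by auto
  ultimately show False using Ks(4) by (metis subset_singletonD)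
qed

section \<open>Roots of unity and conjugation of relations\<close>

lemma zeta_root_power: "zeta_root q ^ a = exp (2 * of_real pi * \<i> * of_real (real a / real q))"
  by (simp add: zeta_root_def exp_of_nat_mult[symmetric] mult_ac)

lemma zeta_root_power_eq_1_iff:
  assumes "q > 0"
  shows "zeta_root q ^ a = 1 \<longleftrightarrow> q dvd a"
proof -
  have "zeta_root q ^ a = 1 \<longleftrightarrow> complex_of_real (real a / real q) \<in> \<int>"
    unfolding zeta_root_power by (rule exp_two_pi_ii_eq_1_iff)
  also have "\<dots> \<longleftrightarrow> q dvd a"
  proof
    assume "complex_of_real (real a / real q) \<in> \<int>"
    then obtain n :: int where "complex_of_real (real a / real q) = of_int n" by (rule Ints_cases)
    hence "real a / real q = of_int n" by (metis of_real_eq_iff of_real_of_int_eq)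
    hence "real_of_int (int a) = of_int (n * int q)" using assms by (simp add: field_simps)
    hence "int a = n * int q" by (simp only: of_int_eq_iff)
    thus "q dvd a" by (metis dvd_triv_right int_dvd_int_iff)
  qed (use assms in \<open>auto elim!: dvdE\<close>)
  finally show ?thesis .
qed

lemma zeta_root_power_mod:
  assumes "q > 0"
  shows "zeta_root q ^ (a mod q) = zeta_root q ^ a"
proof -
  have "zeta_root q ^ a = (zeta_root q ^ q) ^ (a div q) * zeta_root q ^ (a mod q)"
    by (simp add: power_mult[symmetric] power_add[symmetric])
  thus ?thesis using zeta_root_power_eq_1_iff[OF assms, of q] by simp
qed

text \<open>Up to a constant, the derivative of order \<open>m\<close> of
  \<open>cot (pi * z)\<close>, written as a rational function of
  \<open>w = exp (2 * pi * i * z)\<close>.\<close>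

definition cot_value :: "nat \<Rightarrow> complex \<Rightarrow> complex" where
  "cot_value m w = int_eval (cot_poly m) w / (w - 1) ^ Suc m"

text \<open>Clearing denominators turns the relation into an integral polynomial equation for
  \<open>z\<close>, which passes to \<open>z ^ b\<close>. The denominators are nonzero there too and
  can be divided out again.\<close>

lemma cot_value_relation_conjugate:
  fixes c :: "nat \<Rightarrow> int"
  assumes H: "finite H" and z: "n > 0" "z ^ n = 1" and b: "coprime b n" "b > 0"
    and nz: "\<And>a. a \<in> H \<Longrightarrow> z ^ a \<noteq> 1" "\<And>a. a \<in> H \<Longrightarrow> (z ^ b) ^ a \<noteq> 1"
    and rel: "(\<Sum>a\<in>H. of_int (c a) * cot_value m (z ^ a)) = 0"
  shows "(\<Sum>a\<in>H. of_int (c a) * cot_value m ((z ^ b) ^ a)) = 0"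
proof -
  define F where "F = (\<Sum>a\<in>H. smult (c a) (pcompose (cot_poly m) (monom 1 a) *
      (\<Prod>a'\<in>H - {a}. (monom 1 a' - 1) ^ Suc m)))"
  have F: "int_eval F y = (\<Prod>a\<in>H. (y ^ a - 1) ^ Suc m) * (\<Sum>a\<in>H. of_int (c a) * cot_value m (y ^ a))"
    if y: "\<And>a. a \<in> H \<Longrightarrow> y ^ a \<noteq> 1" for y :: complex
    unfolding sum_distrib_left F_def int_eval_sum
  proof (rule sum.cong[OF refl])
    fix a assume a: "a \<in> H"
    have "(\<Prod>a\<in>H. (y ^ a - 1) ^ Suc m) = (y ^ a - 1) ^ Suc m * (\<Prod>a'\<in>H - {a}. (y ^ a' - 1) ^ Suc m)"
      using H a by (rule prod.remove)
    moreover have "(y ^ a - 1) ^ Suc m * cot_value m (y ^ a) = int_eval (cot_poly m) (y ^ a)"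
      using y[OF a] by (simp add: cot_value_def)
    ultimately show "int_eval (smult (c a) (pcompose (cot_poly m) (monom 1 a) * (\<Prod>a'\<in>H - {a}. (monom 1 a' - 1) ^ Suc m))) y =
        (\<Prod>a\<in>H. (y ^ a - 1) ^ Suc m) * (of_int (c a) * cot_value m (y ^ a))"
      by (simp add: mult_ac del: power_Suc)
  qed
  have "int_eval F z = 0" using F[OF nz(1)] rel by simp
  hence "int_eval F (z ^ b) = 0" by (rule int_eval_coprime_power_root[OF z b])
  thus ?thesis using F[OF nz(2)] H nz(2) by (simp add: prod_zero_iff)
qed

section \<open>Values of the Hurwitz zeta function\<close>

definition real_hurwitz_zeta :: "nat \<Rightarrow> real \<Rightarrow> real" where
  "real_hurwitz_zeta k x = (\<Sum>n. inverse ((x + real n) ^ k))"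

lemma real_hurwitz_zeta_sums:
  assumes "k > 1" "x > 0"
  shows "(\<lambda>n. inverse ((x + real n) ^ k)) sums real_hurwitz_zeta k x"
  unfolding real_hurwitz_zeta_def
  using Polygamma_converges'[of x k] assms by (intro summable_sums) auto

lemma hurwitz_zeta_of_real:
  assumes "k > 1" "x > 0"
  shows "hurwitz_zeta (of_nat k) x = of_real (real_hurwitz_zeta k x)"
proof -
  have "(\<lambda>n. complex_of_real (inverse ((x + real n) ^ k))) sums of_real (real_hurwitz_zeta k x)"
    using real_hurwitz_zeta_sums[OF assms] by (simp only: sums_of_real_iff)
  thus ?thesis
    using sums_unique2[OF hurwitz_zeta_of_nat[OF assms]] by simp
qed

lemma real_hurwitz_zeta_ge:
  assumes "k > 1" "x > 0"
  shows "inverse (x ^ k) \<le> real_hurwitz_zeta k x"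
proof -
  have "(\<Sum>n<1. inverse ((x + real n) ^ k)) \<le> real_hurwitz_zeta k x"
    unfolding real_hurwitz_zeta_def
    using real_hurwitz_zeta_sums[OF assms] assms
    by (intro sum_le_suminf) (auto simp: sums_iff)
  thus ?thesis by simp
qed

lemma real_hurwitz_zeta_pos:
  assumes "k > 1" "x > 0"
  shows "real_hurwitz_zeta k x > 0"
proof -
  have "0 < inverse (x ^ k)" using assms by simp
  also have "\<dots> \<le> real_hurwitz_zeta k x" by (rule real_hurwitz_zeta_ge[OF assms])
  finally show ?thesis .
qed

lemma real_hurwitz_zeta_1_le_2:
  assumes "k > 1"
  shows "real_hurwitz_zeta k 1 \<le> 2"
  unfolding real_hurwitz_zeta_def
proof (rule suminf_le_const)
  show "summable (\<lambda>n. inverse ((1 + real n) ^ k))"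
    using real_hurwitz_zeta_sums[OF assms, of 1] by (simp add: sums_iff)
  have bound: "(\<Sum>n<Suc N. inverse ((1 + real n) ^ k)) \<le> 2 - 1 / (real N + 1)" for N
  proof (induction N)
    case (Suc N)
    have "inverse ((1 + real (Suc N)) ^ k) \<le> inverse ((1 + real (Suc N)) ^ 2)"
      using assms by (intro le_imp_inverse_le power_increasing) auto
    \<comment> \<open>The comparison series telescopes.\<close>
    also have "\<dots> \<le> inverse ((real N + 1) * (real N + 2))"
      by (rule le_imp_inverse_le, simp add: power2_eq_square algebra_simps, intro mult_pos_pos) auto
    also have "\<dots> = 1 / (real N + 1) - 1 / (real (Suc N) + 1)"
      by (simp add: field_simps)
    finally show ?case using Suc by simp
  qed simp
  show "(\<Sum>n<N. inverse ((1 + real n) ^ k)) \<le> 2" for N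
  proof (cases N)
    case (Suc M)
    show ?thesis unfolding Suc by (rule order_trans[OF bound]) simp
  qed simp
qed

text \<open>Every positive integer is \<open>n * q + r\<close> for exactly one \<open>n\<close> and
  one \<open>r\<close> in \<open>{1..q}\<close>, so the sum equals \<open>q ^ k\<close> times the
  zeta value at \<open>k\<close>. In the blocks below, index \<open>j\<close> stands for the integer
  \<open>j + 1\<close>.\<close>

lemma sum_real_hurwitz_zeta_le:
  assumes "k > 1" "q > 0"
  shows "(\<Sum>r=1..q. real_hurwitz_zeta k (real r / real q)) \<le> 2 * real q ^ k"
proof -
  let ?f = "\<lambda>j. inverse ((1 + real j) ^ k)"
  have "(\<lambda>n. sum ?f {n * q..<n * q + q}) sums real_hurwitz_zeta k 1"
    using real_hurwitz_zeta_sums[OF assms(1), of 1] assms(2) by (intro sums_group) auto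
  hence "(\<lambda>n. real q ^ k * sum ?f {n * q..<n * q + q}) sums (real q ^ k * real_hurwitz_zeta k 1)"
    by (rule sums_mult)
  moreover have "real q ^ k * sum ?f {n * q..<n * q + q}
      = (\<Sum>r=1..q. inverse ((real r / real q + real n) ^ k))" for n
  proof -
    have "sum ?f {n * q..<n * q + q} = (\<Sum>i=0..<q. ?f (i + n * q))"
      using sum.shift_bounds_nat_ivl[of ?f 0 "n * q" q] by (simp add: add.commute)
    also have "\<dots> = (\<Sum>r=1..q. ?f (r - 1 + n * q))"
      by (rule sum.reindex_bij_witness[of _ "\<lambda>r. r - 1" Suc]) auto
    finally have "real q ^ k * sum ?f {n * q..<n * q + q} = (\<Sum>r=1..q. real q ^ k * ?f (r - 1 + n * q))"
      by (simp add: sum_distrib_left)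
    also have "\<dots> = (\<Sum>r=1..q. inverse ((real r / real q + real n) ^ k))"
    proof (rule sum.cong[OF refl])
      fix r assume "r \<in> {1..q}"
      hence "1 + real (r - 1 + n * q) = real r + real n * real q"
        by (simp add: of_nat_diff)
      hence "real r / real q + real n = (1 + real (r - 1 + n * q)) / real q"
        using assms(2) by (simp add: add_divide_distrib)
      thus "real q ^ k * ?f (r - 1 + n * q) = inverse ((real r / real q + real n) ^ k)"
        by (simp add: power_divide inverse_eq_divide)
    qed
    finally show ?thesis .
  qed
  ultimately have total: "(\<lambda>n. \<Sum>r=1..q. inverse ((real r / real q + real n) ^ k)) sums (real q ^ k * real_hurwitz_zeta k 1)"
    by simp
  have "(\<lambda>n. \<Sum>r=1..q. inverse ((real r / real q + real n) ^ k)) sums (\<Sum>r=1..q. real_hurwitz_zeta k (real r / real q))"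
    using assms by (intro sums_sum real_hurwitz_zeta_sums) auto
  hence "(\<Sum>r=1..q. real_hurwitz_zeta k (real r / real q)) = real q ^ k * real_hurwitz_zeta k 1"
    using total by (rule sums_unique2)
  also have "\<dots> \<le> real q ^ k * 2"
    using real_hurwitz_zeta_1_le_2[OF assms(1)] by (intro mult_left_mono) auto
  finally show ?thesis by (simp add: mult.commute)
qed

section \<open>Residues below \<open>q / 2\<close> and the numbers spanning
  \<open>V_ar\<close>\<close>

definition half_totatives :: "nat \<Rightarrow> nat set" where
  "half_totatives q = {a \<in> {1..<q}. 2 * a < q \<and> coprime a q}"

lemma finite_half_totatives [simp]: "finite (half_totatives q)"
  by (simp add: half_totatives_def)

lemma coprime_diff_self_iff:
  fixes a q :: nat
  assumes "a \<le> q"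
  shows "coprime (q - a) q \<longleftrightarrow> coprime a q"
proof -
  have "gcd (q - a) q = gcd q a"
    using gcd_diff1_nat[OF assms] gcd_diff2_nat[OF assms] by (metis assms diff_diff_cancel diff_le_self gcd.commute gcd_diff1_nat)
  thus ?thesis by (simp add: coprime_iff_gcd_eq_1 gcd.commute)
qed

text \<open>The map from \<open>a\<close> to \<open>q - a\<close> pairs the totatives below
  \<open>q / 2\<close> with those above; \<open>q / 2\<close> itself is not coprime to
  \<open>q\<close> because \<open>q > 2\<close>.\<close>

lemma two_card_half_totatives:
  assumes "q > 2"
  shows "2 * card (half_totatives q) = totient q"
proof -
  let ?H = "half_totatives q"
  have eq: "totatives q = ?H \<union> (\<lambda>a. q - a) ` ?H"
  proof (intro equalityI subsetI)
    fix a assume a: "a \<in> totatives q"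
    have "a \<noteq> q" using a assms by (auto simp: in_totatives_iff)
    hence c: "coprime a q" "0 < a" "a < q"
      using a by (auto simp: in_totatives_iff)
    have "2 * a \<noteq> q"
    proof
      assume q: "2 * a = q"
      hence "a dvd q" by (metis dvd_triv_right)
      hence "a = 1" using c(1) by (metis coprime_common_divisor_nat dvd_refl)
      thus False using q assms by simp
    qed
    show "a \<in> ?H \<union> (\<lambda>a. q - a) ` ?H"
    proof (cases "2 * a < q")
      case True
      with c show ?thesis by (auto simp: half_totatives_def)
    next
      case False
      hence "q - a \<in> ?H" using c \<open>2 * a \<noteq> q\<close> by (auto simp: half_totatives_def coprime_diff_self_iff)
      moreover have "a = q - (q - a)" using c by simp
      ultimately show ?thesis by blast
    qed
  next
    fix a assume "a \<in> ?H \<union> (\<lambda>a. q - a) ` ?H"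
    thus "a \<in> totatives q" by (auto simp: half_totatives_def in_totatives_iff coprime_diff_self_iff)
  qed
  have "card (totatives q) = card ?H + card ((\<lambda>a. q - a) ` ?H)"
    unfolding eq by (rule card_Un_disjoint) (auto simp: half_totatives_def)
  moreover have "inj_on (\<lambda>a. q - a) ?H"
    by (auto simp: inj_on_def half_totatives_def)
  ultimately show ?thesis by (simp add: totient_def card_image)
qed

definition ar_value :: "nat \<Rightarrow> nat \<Rightarrow> nat \<Rightarrow> complex" where
  "ar_value k q a = hurwitz_zeta (of_nat k) (real a / real q)
     + (- 1) ^ k * hurwitz_zeta (of_nat k) (1 - real a / real q)"

lemma ar_value_of_real:
  assumes "k > 1" "0 < a" "a < q"
  shows "ar_value k q a = of_real (real_hurwitz_zeta k (real a / real q)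
    + (- 1) ^ k * real_hurwitz_zeta k (real (q - a) / real q))"
proof -
  have "1 - real a / real q = real (q - a) / real q"
    using assms by (simp add: of_nat_diff diff_divide_distrib)
  thus ?thesis using assms by (simp add: ar_value_def hurwitz_zeta_of_real)
qed

text \<open>A rational multiple of \<open>(pi * i) ^ (m + 1)\<close>. It does not depend on
  \<open>a\<close>, so it cancels from homogeneous relations.\<close>

definition ar_period :: "nat \<Rightarrow> complex" where
  "ar_period m = (- 1) ^ m / fact m * ((of_real pi * \<i>) * (2 * of_real pi * \<i>) ^ m)"

lemma ar_period_nonzero: "ar_period m \<noteq> 0"
  by (simp add: ar_period_def)

lemma ar_value_eq_cot_value:
  assumes "m > 0" "0 < a" "a < q"
  shows "ar_value (Suc m) q a = ar_period m * cot_value m (zeta_root q ^ a)"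
  unfolding ar_value_def ar_period_def cot_value_def zeta_root_power
  by (rule hurwitz_zeta_reflection) (use assms in auto)

lemma half_totatives_mult_mod:
  assumes "q > 2" "a \<in> half_totatives q" "coprime b q"
  shows "a * b mod q \<in> {0<..<q}"
proof -
  have cop: "coprime (a * b) q" using assms by (auto simp: half_totatives_def)
  have "\<not> q dvd a * b"
  proof
    assume "q dvd a * b"
    hence "q = 1" using cop by (metis coprime_common_divisor_nat dvd_refl)
    thus False using assms(1) by simp
  qed
  thus ?thesis using assms(1) by (auto simp: dvd_eq_mod_eq_0)
qed

text \<open>Divided by the common period the relation is one between algebraic numbers; it is
  conjugated there and multiplied by the period again.\<close>

lemma ar_value_relation_conjugate:
  fixes c :: "nat \<Rightarrow> int"
  assumes k: "k > 1" and q: "q > 2" and b: "coprime b q" "b > 0"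
    and rel: "(\<Sum>a\<in>half_totatives q. of_int (c a) * ar_value k q a) = 0"
  shows "(\<Sum>a\<in>half_totatives q. of_int (c a) * ar_value k q (a * b mod q)) = 0"
proof -
  obtain m where m: "k = Suc m" "m > 0" using k by (cases k) auto
  let ?H = "half_totatives q" and ?z = "zeta_root q"
  have range: "a * b mod q \<in> {0<..<q}" if "a \<in> ?H" for a
    by (rule half_totatives_mult_mod[OF q that b(1)])
  have rangeH: "a \<in> {0<..<q}" if "a \<in> ?H" for a
    using that by (auto simp: half_totatives_def)
  have mod: "(?z ^ b) ^ a = ?z ^ (a * b mod q)" for a
    using q by (simp add: zeta_root_power_mod power_mult[symmetric] mult.commute)
  have "(\<Sum>a\<in>?H. of_int (c a) * ar_value k q a) = ar_period m * (\<Sum>a\<in>?H. of_int (c a) * cot_value m (?z ^ a))"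
    unfolding sum_distrib_left using m rangeH
    by (intro sum.cong) (auto simp: ar_value_eq_cot_value)
  with rel have zero: "(\<Sum>a\<in>?H. of_int (c a) * cot_value m (?z ^ a)) = 0"
    by (simp add: ar_period_nonzero)
  have nz: "?z ^ a \<noteq> 1" if "a \<in> {0<..<q}" for a
    using that q by (auto simp: zeta_root_power_eq_1_iff dest: dvd_imp_le)
  have z1: "?z ^ q = 1" using q by (simp add: zeta_root_power_eq_1_iff)
  have "(\<Sum>a\<in>?H. of_int (c a) * cot_value m ((?z ^ b) ^ a)) = 0"
    by (rule cot_value_relation_conjugate[OF finite_half_totatives _ z1 b _ _ zero])
       (use q nz[OF rangeH] nz[OF range] in \<open>simp_all add: mod\<close>)
  hence "0 = ar_period m * (\<Sum>a\<in>?H. of_int (c a) * cot_value m (?z ^ (a * b mod q)))"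
    by (simp add: mod)
  also have "\<dots> = (\<Sum>a\<in>?H. of_int (c a) * ar_value k q (a * b mod q))"
    unfolding sum_distrib_left using m range
    by (intro sum.cong) (auto simp: ar_value_eq_cot_value)
  finally show ?thesis by simp
qed

section \<open>Linear independence\<close>

theorem ar_value_int_independent:
  fixes c :: "nat \<Rightarrow> int"
  assumes k: "k > 1" and q: "q > 2"
    and rel: "(\<Sum>a\<in>half_totatives q. of_int (c a) * ar_value k q a) = 0"
    and a: "a \<in> half_totatives q"
  shows "c a = 0"
proof (rule ccontr)
  assume "c a \<noteq> 0"
  let ?H = "half_totatives q"
  define M where "M = Max ((\<lambda>a. \<bar>c a\<bar>) ` ?H)"
  have M: "\<bar>c a\<bar> \<le> M" if "a \<in> ?H" for a
    using that by (auto simp: M_def)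
  have "M \<in> (\<lambda>a. \<bar>c a\<bar>) ` ?H"
    unfolding M_def using a by (intro Max_in) auto
  then obtain a0 where a0: "a0 \<in> ?H" "\<bar>c a0\<bar> = M" by auto
  have "M > 0" using M[OF a] \<open>c a \<noteq> 0\<close> by linarith
  \<comment> \<open>Conjugation by the inverse of \<open>a0\<close> moves the largest coefficient to
    residue 1, where the zeta value is largest.\<close>
  obtain b where cong: "[a0 * b = 1] (mod q)"
    using cong_solve_coprime_nat[of a0 q] a0 by (auto simp: half_totatives_def)
  hence b1: "a0 * b mod q = 1" using q by (simp add: cong_def)
  have "coprime (a0 * b) q" using cong_imp_coprime[OF cong_sym[OF cong]] by simp
  hence b: "coprime b q" "b > 0" using b1 by (auto intro!: Nat.gr0I)
  define g where "g r = real_hurwitz_zeta k (real r / real q)" for r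
  define r where "r a = a * b mod q" for a
  define y where "y a = g (r a) + (- 1) ^ k * g (q - r a)" for a
  have range: "r a \<in> {0<..<q}" if "a \<in> ?H" for a
    unfolding r_def by (rule half_totatives_mult_mod[OF q that b(1)])
  have g_pos: "g r > 0" if "r > 0" for r
    unfolding g_def using that q k by (intro real_hurwitz_zeta_pos) auto
  have "(\<Sum>a\<in>?H. of_int (c a) * ar_value k q (r a)) = (\<Sum>a\<in>?H. of_real (of_int (c a) * y a))"
    using range k by (intro sum.cong) (auto simp: ar_value_of_real y_def g_def)
  moreover have "(\<Sum>a\<in>?H. of_int (c a) * ar_value k q (r a)) = 0"
    unfolding r_def by (rule ar_value_relation_conjugate[OF k q b rel])
  ultimately have "complex_of_real (\<Sum>a\<in>?H. of_int (c a) * y a) = 0" by simp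
  hence "(\<Sum>a\<in>?H. of_int (c a) * y a) = 0" by (simp only: of_real_eq_0_iff)
  hence "of_int (c a0) * y a0 = - (\<Sum>a\<in>?H - {a0}. of_int (c a) * y a)"
    using a0 by (simp add: sum.remove)
  moreover have "\<bar>of_int (c a0)\<bar> = (of_int M :: real)" using a0(2) by (simp flip: of_int_abs)
  ultimately have "of_int M * \<bar>y a0\<bar> = \<bar>\<Sum>a\<in>?H - {a0}. of_int (c a) * y a\<bar>"
    by (metis abs_minus_cancel abs_mult)
  also have "\<dots> \<le> (\<Sum>a\<in>?H - {a0}. of_int M * (g (r a) + g (q - r a)))"
  proof (rule order_trans[OF sum_abs], rule sum_mono)
    fix a assume "a \<in> ?H - {a0}"
    hence a: "a \<in> ?H" by simp
    have "g (r a) > 0" "g (q - r a) > 0" using range[OF a] by (auto intro: g_pos)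
    hence "\<bar>y a\<bar> \<le> g (r a) + g (q - r a)"
      unfolding y_def by (cases "even k") auto
    moreover have "\<bar>of_int (c a)\<bar> \<le> (of_int M :: real)"
      using M[OF a] by (metis of_int_abs of_int_le_iff)
    ultimately show "\<bar>of_int (c a) * y a\<bar> \<le> of_int M * (g (r a) + g (q - r a))"
      unfolding abs_mult using \<open>M > 0\<close> by (intro mult_mono) auto
  qed
  also have "\<dots> = of_int M * (\<Sum>a\<in>?H - {a0}. g (r a) + g (q - r a))"
    by (rule sum_distrib_left[symmetric])
  finally have "\<bar>y a0\<bar> \<le> (\<Sum>a\<in>?H - {a0}. g (r a) + g (q - r a))"
    using \<open>M > 0\<close> by simp
  \<comment> \<open>Since \<open>r a0 = 1\<close>, the lower bound is
    \<open>g 1 - g (q - 1)\<close>, which is valid for either parity of \<open>k\<close>.\<close>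
  moreover have "2 * g 1 - (g (r a0) + g (q - r a0)) \<le> \<bar>y a0\<bar>"
    using g_pos[of 1] g_pos[of "q - 1"] q unfolding y_def r_def b1
    by (cases "even k") auto
  ultimately have "2 * g 1 \<le> (\<Sum>a\<in>?H. g (r a) + g (q - r a))"
    using sum.remove[OF finite_half_totatives a0(1), of "\<lambda>a. g (r a) + g (q - r a)"] by linarith
  also have "\<dots> = (\<Sum>s\<in>r ` ?H. g s) + (\<Sum>s\<in>(\<lambda>a. q - r a) ` ?H. g s)"
  proof -
    have inj: "inj_on r ?H"
    proof (rule inj_onI)
      fix a a' assume *: "a \<in> ?H" "a' \<in> ?H" "r a = r a'"
      hence "[a * b = a' * b] (mod q)" by (simp add: r_def cong_def)
      hence "[a = a'] (mod q)" using b by (simp add: cong_mult_rcancel_nat)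
      thus "a = a'" using * by (auto simp: half_totatives_def cong_def)
    qed
    have "inj_on (\<lambda>a. q - r a) ?H"
    proof (rule inj_onI)
      fix a a' assume *: "a \<in> ?H" "a' \<in> ?H" "q - r a = q - r a'"
      hence "r a = r a'" using range[of a] range[of a'] by auto
      with inj * show "a = a'" by (auto dest: inj_onD)
    qed
    with inj show ?thesis by (simp add: sum.distrib sum.reindex o_def)
  qed
  also have "\<dots> = (\<Sum>s\<in>r ` ?H \<union> (\<lambda>a. q - r a) ` ?H. g s)"
  proof (rule sum.union_disjoint[symmetric])
    \<comment> \<open>Equality would give \<open>q dvd a + a'\<close>, although
      \<open>0 < a + a' < q\<close>. So every residue occurs at most once in the combined
      sum.\<close>
    have "r a \<noteq> q - r a'" if "a \<in> ?H" "a' \<in> ?H" for a a'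
    proof
      assume "r a = q - r a'"
      hence "r a + r a' = q" using range[OF that(2)] by auto
      hence "(a * b mod q + a' * b mod q) mod q = 0" by (simp add: r_def)
      hence "(a * b + a' * b) mod q = 0" by (simp only: mod_add_eq)
      hence "q dvd (a + a') * b" by (simp add: distrib_right mod_0_imp_dvd)
      hence "q dvd a + a'" using b by (simp add: coprime_dvd_mult_left_iff coprime_commute)
      thus False using that by (auto simp: half_totatives_def dest: dvd_imp_le)
    qed
    thus "r ` ?H \<inter> (\<lambda>a. q - r a) ` ?H = {}" by blast
  qed auto
  also have "\<dots> \<le> (\<Sum>s\<in>{1..q} - {q}. g s)"
  proof (rule sum_mono2)
    show "r ` ?H \<union> (\<lambda>a. q - r a) ` ?H \<subseteq> {1..q} - {q}"
      using range by fastforce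
  qed (auto simp: g_pos less_imp_le)
  also have "\<dots> = (\<Sum>s=1..q. g s) - g q"
    using q by (simp add: sum_diff1)
  \<comment> \<open>The positive term \<open>g q\<close> makes the estimate strict, as the final
    contradiction with \<open>g 1 \<ge> q ^ k\<close> requires.\<close>
  also have "\<dots> < (\<Sum>s=1..q. g s)" using g_pos[of q] q by simp
  also have "\<dots> \<le> 2 * real q ^ k"
    unfolding g_def using k q by (intro sum_real_hurwitz_zeta_le) auto
  finally have "g 1 < real q ^ k" by simp
  moreover have "real q ^ k \<le> g 1"
    unfolding g_def using real_hurwitz_zeta_ge[of k "1 / real q"] k q by (simp add: power_divide)
  ultimately show False by simp
qed

corollary ar_value_rat_independent:
  fixes c :: "nat \<Rightarrow> complex"
  assumes "k > 1" "q > 2" and rat: "\<And>a. a \<in> half_totatives q \<Longrightarrow> c a \<in> \<rat>"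
    and rel: "(\<Sum>a\<in>half_totatives q. c a * ar_value k q a) = 0" and a: "a \<in> half_totatives q"
  shows "c a = 0"
proof -
  obtain b :: nat where b: "b > 0" "\<And>a. a \<in> half_totatives q \<Longrightarrow> of_nat b * c a \<in> \<int>"
    using common_denominator[of "half_totatives q" c] rat by auto
  hence "\<forall>a\<in>half_totatives q. \<exists>n::int. of_nat b * c a = of_int n" by (auto elim: Ints_cases)
  then obtain e :: "nat \<Rightarrow> int" where e: "\<And>a. a \<in> half_totatives q \<Longrightarrow> of_nat b * c a = of_int (e a)"
    by metis
  have "(\<Sum>a\<in>half_totatives q. of_int (e a) * ar_value k q a) = of_nat b * (\<Sum>a\<in>half_totatives q. c a * ar_value k q a)"
    unfolding sum_distrib_left by (intro sum.cong) (simp_all add: e[symmetric] mult.assoc)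
  hence "(\<Sum>a\<in>half_totatives q. of_int (e a) * ar_value k q a) = 0" using rel by simp
  hence "e a = 0" by (rule ar_value_int_independent[OF assms(1,2) _ a])
  with e[OF a] b(1) show ?thesis by simp
qed

section \<open>Independence from the number 1\<close>

lemma algebraic_zeta_root:
  assumes "q > 0"
  shows "algebraic (zeta_root q)"
proof (rule algebraic_root[of 1 "monom 1 q"])
  show "poly (monom 1 q) (zeta_root q) = 1"
    using zeta_root_power_eq_1_iff[OF assms, of q] by (simp add: poly_monom)
qed (use assms in \<open>auto simp: degree_monom_eq\<close>)

lemma algebraic_cot_value: "algebraic w \<Longrightarrow> algebraic (cot_value m w)"
  unfolding cot_value_def
  using algebraic_complex_add[of w "- 1"]
  by (intro algebraic_complex_divide algebraic_complex_power algebraic_int_eval) auto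

text \<open>The combination is \<open>(pi * i) ^ k\<close> times an algebraic number; a nonzero
  rational value would make that power of \<open>pi * i\<close> algebraic.\<close>

theorem rat_combination_ar_value_eq_0:
  fixes c :: "nat \<Rightarrow> complex"
  assumes "k > 1" "q > 2" and rat: "\<And>a. a \<in> half_totatives q \<Longrightarrow> c a \<in> \<rat>"
    and s_rat: "(\<Sum>a\<in>half_totatives q. c a * ar_value k q a) \<in> \<rat>"
  shows "(\<Sum>a\<in>half_totatives q. c a * ar_value k q a) = 0"
proof (rule ccontr)
  let ?H = "half_totatives q"
  define s where "s = (\<Sum>a\<in>?H. c a * ar_value k q a)"
  obtain m where m: "k = Suc m" "m > 0" using assms(1) by (cases k) auto
  assume "(\<Sum>a\<in>?H. c a * ar_value k q a) \<noteq> 0"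
  hence nz: "s \<noteq> 0" by (simp add: s_def)
  define t where "t = (\<Sum>a\<in>?H. c a * cot_value m (zeta_root q ^ a))"
  have t: "algebraic t"
    unfolding t_def
  proof (intro algebraic_complex_sum algebraic_complex_mult algebraic_cot_value algebraic_complex_power algebraic_zeta_root)
    show "algebraic (c a)" if "a \<in> ?H" for a by (rule rat_imp_algebraic[OF rat[OF that]])
  qed (use assms(2) in simp)
  define u :: complex where "u = (- 1) ^ m * 2 ^ m / of_nat (fact m)"
  have u: "algebraic u"
    unfolding u_def by (intro rat_imp_algebraic Rats_divide Rats_mult Rats_power Rats_of_nat) auto
  have "s = ar_period m * t"
    unfolding s_def t_def sum_distrib_left using m
    by (intro sum.cong) (auto simp: ar_value_eq_cot_value half_totatives_def)
  also have "ar_period m = (\<i> * of_real pi) ^ k * u"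
    by (simp add: ar_period_def u_def m(1) power_mult_distrib mult_ac)
  finally have s: "s = (\<i> * of_real pi) ^ k * (u * t)" by (simp only: mult.assoc)
  hence "u * t \<noteq> 0" using nz by auto
  hence "(\<i> * of_real pi) ^ k = s / (u * t)" using s by (simp only: nonzero_mult_div_cancel_right not_False_eq_True)
  moreover have "algebraic (s / (u * t))"
    using s_rat by (intro algebraic_complex_divide algebraic_complex_mult u t rat_imp_algebraic) (simp add: s_def)
  ultimately show False using not_algebraic_ii_pi_power[of k] assms(1) by simp
qed

lemma combine_map:
  "complex_ring.combine (map c as) (map x as) = (\<Sum>a\<leftarrow>as. c a * x a)"
  by (induction as) auto

text \<open>Turns a coefficient list into a function of the index \<open>a\<close>, so that
  relations between lists become finite sums.\<close>

lemma list_eq_map_of_distinct: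
  assumes "distinct as" "length rs = length as"
  obtains c where "rs = map c as"
proof -
  have "rs = map (\<lambda>a. the (map_of (zip as rs) a)) as"
    using assms by (intro nth_equalityI) (auto simp: map_of_zip_nth)
  thus thesis by (rule that)
qed

theorem theorem4p3:
  fixes k q d :: nat and K :: "complex set"
  assumes "k > 1" and "q > 2" and "d \<ge> 1" and "squarefree d"
    and "K = rat_adjoin (\<i> * complex_of_real (sqrt (real d)))"
    and "K \<inter> rat_adjoin (zeta_root q) = rat_adjoin (\<i> * complex_of_real (sqrt (real d)))"
  shows "ring.finite_dimension complex_ring K (V_ar k q K)
       \<and> real (ring.dim complex_ring K (V_ar k q K)) = real (totient q) / 2
       \<and> ring.finite_dimension complex_ring K (V_hat k q K)
       \<and> real (ring.dim complex_ring K (V_hat k q K)) \<ge> real (totient q) / 2 + 1"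
proof -
  have K: "subfield K complex_ring" unfolding assms(5) by (rule subfield_rat_adjoin)
  let ?H = "half_totatives q"
  define as where "as = filter (\<lambda>a. 2 * a < q \<and> coprime a q) [1..<q]"
  define Us where "Us = map (ar_value k q) as"
  have as: "distinct as" "set as = ?H" by (auto simp: as_def half_totatives_def)
  have len: "2 * length Us = totient q"
    using two_card_half_totatives[OF assms(2)] as distinct_card[of as] by (simp add: Us_def)
  have V_ar: "V_ar k q K = complex_ring.Span K Us"
    by (simp add: V_ar_def Us_def as_def ar_value_def[abs_def])
  have sum: "complex_ring.combine (map c as) Us = (\<Sum>a\<in>?H. c a * ar_value k q a)" for c
    unfolding Us_def combine_map using as by (simp add: sum_list_distinct_conv_sum_set)
  have "ar_value k q a \<in> \<real>" if "a \<in> ?H" for a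
  proof -
    have "0 < a" "a < q" using that by (auto simp: half_totatives_def)
    thus ?thesis by (simp only: ar_value_of_real[OF assms(1)] Reals_of_real)
  qed
  hence real: "set Us \<subseteq> \<real>" using as by (auto simp: Us_def)
  \<comment> \<open>This serves both claims: without the head it gives the dimension of
    \<open>V_ar\<close>, with it the extra 1 in the bound for \<open>V_hat\<close>.\<close>
  have indep1: "complex_ring.independent K (1 # Us)"
  proof (rule independent_imaginary_quadratic[OF assms(3,5)])
    show "set (1 # Us) \<subseteq> \<real>" using real by simp
    fix rs :: "complex list"
    assume rs: "length rs = length (1 # Us)" "set rs \<subseteq> \<rat>" "complex_ring.combine rs (1 # Us) = 0"
    then obtain t ts where ts: "rs = t # ts" "length ts = length as" by (cases rs) (auto simp: Us_def)
    obtain c where c: "ts = map c as" using list_eq_map_of_distinct[OF as(1) ts(2)] .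
    have rat: "t \<in> \<rat>" "\<And>a. a \<in> ?H \<Longrightarrow> c a \<in> \<rat>" using rs(2) ts c as by auto
    have "t + (\<Sum>a\<in>?H. c a * ar_value k q a) = 0" using rs(3) ts c sum by simp
    \<comment> \<open>The combination of the zeta values is rational, hence 0; this forces
      \<open>t = 0\<close> first and then the other coefficients.\<close>
    hence t: "(\<Sum>a\<in>?H. c a * ar_value k q a) = - t" by (simp add: eq_neg_iff_add_eq_0 add.commute)
    have zero: "(\<Sum>a\<in>?H. c a * ar_value k q a) = 0"
      by (rule rat_combination_ar_value_eq_0[OF assms(1,2) rat(2)]) (use t rat(1) in auto)
    have "c a = 0" if "a \<in> ?H" for a
      by (rule ar_value_rat_independent[OF assms(1,2) rat(2) zero that])
    thus "set rs \<subseteq> {0}" using t zero ts c as by auto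
  qed
  hence "complex_ring.independent K Us" by (rule complex_ring.independent_backwards)
  hence dim_ar: "complex_ring.dimension (length Us) K (V_ar k q K)"
    unfolding V_ar by (rule complex_ring.dimension_independent)
  define Ws where "Ws = (1::complex) # map (\<lambda>a. hurwitz_zeta (of_nat k) (real a / real q)) (filter (\<lambda>a. coprime a q) [1..<q])"
  have V_hat: "V_hat k q K = complex_ring.Span K Ws"
    by (simp add: V_hat_def Ws_def)
  have Ws: "set Ws \<subseteq> V_hat k q K"
    unfolding V_hat by (rule complex_ring.Span_base_incl[OF K]) simp
  have fin_hat: "complex_ring.finite_dimension K (V_hat k q K)"
    unfolding V_hat by (rule complex_ring.Span_finite_dimension[OF K]) simp
  \<comment> \<open>With \<open>a\<close> also \<open>q - a\<close> is coprime to \<open>q\<close>,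
    so both zeta values occur among the generators \<open>Ws\<close>.\<close>
  have "ar_value k q a \<in> V_hat k q K" if a: "a \<in> ?H" for a
  proof -
    have aq: "a < q" "0 < a" "coprime a q" using a by (auto simp: half_totatives_def)
    have "real (q - a) / real q = 1 - real a / real q"
      using aq by (simp add: of_nat_diff diff_divide_distrib)
    moreover have "q - a \<in> set (filter (\<lambda>a. coprime a q) [1..<q])"
      using aq by (simp add: coprime_diff_self_iff)
    hence "hurwitz_zeta (of_nat k) (real (q - a) / real q) \<in> set Ws"
      unfolding Ws_def by simp
    ultimately have "hurwitz_zeta (of_nat k) (1 - real a / real q) \<in> V_hat k q K"
      using Ws by auto
    moreover have "hurwitz_zeta (of_nat k) (real a / real q) \<in> V_hat k q K"
      using aq Ws by (auto simp: Ws_def)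
    moreover have "(- 1) ^ k \<in> K"
      using subringE(3,5)[OF subfieldE(1)[OF K]] by (cases "even k") (auto simp: complex_ring_a_inv)
    ultimately show ?thesis
      using complex_ring.Span_subgroup_props(3)[OF K, of Ws] complex_ring.Span_smult_closed[OF K, of Ws]
      unfolding V_hat ar_value_def by simp
  qed
  hence "set (1 # Us) \<subseteq> V_hat k q K"
    using Ws as by (auto simp: Us_def Ws_def)
  hence "length (1 # Us) \<le> complex_ring.dim K (V_hat k q K)"
    using complex_ring.independent_length_le_dimension[OF K complex_ring.finite_dimensionE[OF K fin_hat] indep1]
    by (simp add: over_def)
  moreover have "complex_ring.dim K (V_ar k q K) = length Us"
    using complex_ring.dimI[OF K dim_ar] by (simp add: over_def)
  moreover have "real (totient q) = 2 * real (length Us)"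
    by (simp flip: len)
  ultimately show ?thesis
    using fin_hat complex_ring.finite_dimensionI[OF dim_ar] by simp
qed

end
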